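(* Let $k>0$ and $A>0$, and let $f$ be a multiplicative function with $|f|\le\tau_k$ and $$\sum_{p\le x}f(p)\log p\ll\frac{x}{(\log x)^A}\qquad(x\ge2),$$ the sum being over primes. Then for $x\ge2$, $$\sum_{n\le x}f(n)\ll x(\log x)^{k-1-A},$$ where the implied constant depends at most on $k$, $A$ and the implicit constant in the hypothesis.
   Context: $\tau_k$ is the multiplicative function with $\sum_n\tau_k(n)n^{-s}=\zeta(s)^k$, i.e. $\tau_k(p^\nu)=\binom{k+\nu-1}{\nu}$. *)

theory Defs
  imports "HOL-Analysis.Analysis" "HOL-Computational_Algebra.Primes"
begin

definition multiplicative :: "(nat \<Rightarrow> complex) \<Rightarrow> bool" where
  "multiplicative f \<longleftrightarrow> f 1 = 1 \<and> (\<forall>m n. coprime m n \<longrightarrow> f (m * n) = f m * f n)"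

text \<open>Generalized divisor function tau_k for real k: multiplicative with
  tau_k(p^v) = binom(k+v-1, v).  (Only used for n >= 1.)\<close>
definition tau :: "real \<Rightarrow> nat \<Rightarrow> real" where
  "tau k n = (\<Prod>p\<in>prime_factors n. (k + real (multiplicity p n) - 1) gchoose (multiplicity p n))"

end

theory Submission
  imports Defs
begin

text \<open>
  Replace \<open>f\<close> by the multiplicative function \<open>g\<close> with \<open>g(p^v) = f(p)^v / v!\<close>, whose Dirichlet
  series is \<open>exp (\<Sum> f(p) p^-s)\<close>, so that \<open>g log = g * (f log on primes)\<close> exactly. In
  \<open>\<Sum> g(n) log n = \<Sum> g(m) f(p) log p\<close> over \<open>m p \<le> N\<close>, the terms with \<open>p > N^\<epsilon>\<close> are summed over \<open>p\<close>
  first, where the hypothesis saves \<open>(log N)^A\<close>; for \<open>p \<le> N^\<epsilon>\<close> the sum over \<open>m\<close> is bounded by the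
  induction hypothesis, at the cost of a factor \<open>O(\<epsilon> log N)\<close>. For small fixed \<open>\<epsilon>\<close> this cost is at
  most half of \<open>log N\<close>, and the induction closes. Finally \<open>f = h * g\<close>, where \<open>h\<close> vanishes at primes
  and hence \<open>\<Sum> \<bar>h(d)\<bar> d^(-3/4)\<close> converges.
\<close>

section \<open>Multiplicative functions from their prime power values\<close>

text \<open>For \<open>f\<close> itself a similar exact identity holds with a generalised von
  Mangoldt function, but \<open>\<bar>f\<bar> \<le> tau k\<close> does not tame that function at
  prime powers: a Bell series of \<open>f\<close> may vanish close to 0, and its logarithmic
  derivative then has exponentially growing coefficients. The exponential local factors of g have no
  zeros and contribute at primes only. One constant M has to serve for all N. Passing from the sum
  weighted by log n to the plain sum costs a multiple of M without a logarithm, so division by log N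
  leaves a fraction of M plus an amount independent of M. Since k - 1 - A may have either sign, the
  induction hypothesis is used only at arguments of size at least sqrt N, where the logarithm has
  dropped by at most a factor 2. Elsewhere the trivial bound N (1 + log N)^k is used; its excess,
  about (log N)^(A+1), is absorbed by a spare power of N. The exponent 3/4 lies between 1/2, needed
  for convergence, and 1, so that a factor d^(-1/4) remains to absorb logarithms when d is
  large.\<close>

definition mult_ext :: "(nat \<Rightarrow> nat \<Rightarrow> 'a::comm_semiring_1) \<Rightarrow> nat \<Rightarrow> 'a" where
  "mult_ext u n = (\<Prod>p\<in>prime_factors n. u p (multiplicity p n))"

lemma mult_ext_1 [simp]: "mult_ext u (Suc 0) = 1"
  by (simp add: mult_ext_def)

lemma multiplicity_mult_prime_power_self:
  fixes p m v :: nat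
  assumes "prime p" "\<not> p dvd m"
  shows "multiplicity p (p ^ v * m) = v"
  using assms by (intro multiplicity_decomposeI) (auto simp: prime_gt_0_nat mult.commute)

lemma multiplicity_mult_prime_power_other:
  fixes p q m v :: nat
  assumes "prime p" "prime q" "q \<noteq> p" "m > 0"
  shows "multiplicity q (p ^ v * m) = multiplicity q m"
proof -
  have "multiplicity q (p ^ v) = 0"
    using assms by (intro not_dvd_imp_multiplicity_0) (metis prime_dvd_power primes_dvd_imp_eq)
  thus ?thesis using assms
    by (subst prime_elem_multiplicity_mult_distrib) (auto simp: prime_gt_0_nat)
qed

lemma mult_ext_prime_power_mult:
  fixes p m v :: nat
  assumes "prime p" "\<not> p dvd m" "m > 0" and u0: "u p 0 = 1"
  shows "mult_ext u (p ^ v * m) = u p v * mult_ext u m"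
proof (cases "v = 0")
  case True
  thus ?thesis using u0 by simp
next
  case False
  have pf: "prime_factors (p ^ v * m) = insert p (prime_factors m)"
    using assms False
    by (subst prime_factors_product) (auto simp: prime_factorization_prime_power prime_gt_0_nat)
  have "mult_ext u (p ^ v * m)
      = u p (multiplicity p (p ^ v * m)) * (\<Prod>q\<in>prime_factors m. u q (multiplicity q (p ^ v * m)))"
    unfolding mult_ext_def pf using assms by (subst prod.insert) auto
  also have "(\<Prod>q\<in>prime_factors m. u q (multiplicity q (p ^ v * m))) = mult_ext u m"
    unfolding mult_ext_def
  proof (rule prod.cong)
    fix q assume q: "q \<in> prime_factors m"
    hence "prime q" "q \<noteq> p" using assms by (auto simp: in_prime_factors_iff)
    thus "u q (multiplicity q (p ^ v * m)) = u q (multiplicity q m)"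
      using assms by (simp add: multiplicity_mult_prime_power_other)
  qed simp
  also have "multiplicity p (p ^ v * m) = v"
    using assms by (simp add: multiplicity_mult_prime_power_self)
  finally show ?thesis .
qed

lemma prime_power_mult_induct [consumes 1, case_names one mult]:
  fixes n :: nat
  assumes "n > 0" and "P 1"
    and step: "\<And>p v m. prime p \<Longrightarrow> v > 0 \<Longrightarrow> m > 0 \<Longrightarrow> \<not> p dvd m \<Longrightarrow> P m \<Longrightarrow> P (p ^ v * m)"
  shows "P n"
  using \<open>n > 0\<close>
proof (induction n rule: less_induct)
  case (less n)
  show ?case
  proof (cases "n = 1")
    case False
    then obtain p where p: "prime p" "p dvd n" using prime_factor_nat by blast
    have nz: "n \<noteq> 0" "\<not> is_unit p" using less.prems p by (auto simp: prime_gt_1_nat)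
    obtain m where m: "n = p ^ multiplicity p n * m" "\<not> p dvd m"
      using multiplicity_decompose'[OF nz] by metis
    have v: "multiplicity p n > 0" using p nz by (simp add: multiplicity_gt_zero_iff)
    have m0: "m > 0" using m nz by (cases m) auto
    have "p ^ multiplicity p n > 1" using one_less_power[OF prime_gt_1_nat[OF p(1)] v] .
    hence "m < p ^ multiplicity p n * m" using m0 by simp
    hence "m < n" using m(1) by linarith
    hence "P m" using less.IH m0 by blast
    from step[OF p(1) v m0 m(2) this] show ?thesis by (subst m(1))
  qed (use \<open>P 1\<close> in simp)
qed

lemma multiplicative_eq_mult_ext:
  assumes "multiplicative f" "n > 0"
  shows "f n = mult_ext (\<lambda>p v. f (p ^ v)) n"
  using \<open>n > 0\<close>
proof (induction n rule: prime_power_mult_induct)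
  case one
  show ?case using assms by (simp add: multiplicative_def)
next
  case (mult p v m)
  have "coprime (p ^ v) m" using mult by (simp add: prime_imp_coprime)
  hence "f (p ^ v * m) = f (p ^ v) * f m" using assms by (auto simp: multiplicative_def)
  thus ?case using mult assms
    by (subst mult_ext_prime_power_mult) (auto simp: multiplicative_def)
qed

lemma norm_mult_ext:
  fixes u :: "nat \<Rightarrow> nat \<Rightarrow> 'a::{real_normed_field}"
  shows "norm (mult_ext u n) = mult_ext (\<lambda>p v. norm (u p v)) n"
  by (simp add: mult_ext_def prod_norm)

lemma mult_ext_nonneg:
  fixes u :: "nat \<Rightarrow> nat \<Rightarrow> real"
  assumes "\<And>p v. prime p \<Longrightarrow> u p v \<ge> 0"
  shows "mult_ext u n \<ge> 0"
  unfolding mult_ext_def using assms by (intro prod_nonneg) (auto simp: in_prime_factors_iff)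

lemma mult_ext_mono:
  fixes u w :: "nat \<Rightarrow> nat \<Rightarrow> real"
  assumes "\<And>p v. prime p \<Longrightarrow> 0 \<le> u p v" "\<And>p v. prime p \<Longrightarrow> u p v \<le> w p v"
  shows "mult_ext u n \<le> mult_ext w n"
  unfolding mult_ext_def using assms by (intro prod_mono) (auto simp: in_prime_factors_iff)

text \<open>A power of n can be moved into the local data, so sums weighted by
  \<open>n powr s\<close> are again open to Euler product bounds.\<close>

lemma mult_ext_mult_powr:
  fixes u :: "nat \<Rightarrow> nat \<Rightarrow> real"
  assumes "n > 0"
  shows "mult_ext (\<lambda>p v. u p v * (real p powr s) ^ v) n = mult_ext u n * real n powr s"
proof -
  have "real n powr s = (\<Prod>p\<in>prime_factors n. real p ^ multiplicity p n) powr s"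
    using arg_cong[OF prime_factorization_nat[OF assms], of real] by (simp only: of_nat_prod of_nat_power)
  also have "\<dots> = (\<Prod>p\<in>prime_factors n. (real p powr s) ^ multiplicity p n)"
  proof (subst prod_powr_distrib, goal_cases)
    case 1
    have "(real p ^ v) powr s = (real p powr s) ^ v" if "p > 0" for p v :: nat
      using that by (simp add: powr_realpow[symmetric] powr_powr mult.commute)
    thus ?case by (intro prod.cong refl) (auto simp: prime_factors_gt_0_nat)
  qed
  finally show ?thesis by (simp add: mult_ext_def prod.distrib)
qed

section \<open>Divisor sums and Dirichlet convolution\<close>

lemma divisors_prime_power_mult:
  fixes p m v :: nat
  assumes "prime p" "\<not> p dvd m" "m > 0"
  shows "bij_betw (\<lambda>(i, d). p ^ i * d) ({..v} \<times> {d. d dvd m}) {d. d dvd p ^ v * m}"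
proof (rule bij_betwI')
  fix x y assume xy: "x \<in> {..v} \<times> {d. d dvd m}" "y \<in> {..v} \<times> {d. d dvd m}"
  show "((case x of (i, d) \<Rightarrow> p ^ i * d) = (case y of (i, d) \<Rightarrow> p ^ i * d)) = (x = y)"
  proof
    assume eq: "(case x of (i, d) \<Rightarrow> p ^ i * d) = (case y of (i, d) \<Rightarrow> p ^ i * d)"
    obtain i d j e where [simp]: "x = (i, d)" "y = (j, e)" by (cases x, cases y) auto
    have nd: "\<not> p dvd d" "\<not> p dvd e" using xy assms by (auto dest: dvd_trans)
    have "multiplicity p (p ^ i * d) = multiplicity p (p ^ j * e)" using eq by simp
    hence "i = j" using assms nd by (simp add: multiplicity_mult_prime_power_self)
    thus "x = y" using eq assms by (auto simp: prime_gt_0_nat)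
  qed simp
next
  fix x assume "x \<in> {..v} \<times> {d. d dvd m}"
  thus "(case x of (i, d) \<Rightarrow> p ^ i * d) \<in> {d. d dvd p ^ v * m}"
    by (auto intro!: mult_dvd_mono simp: le_imp_power_dvd)
next
  fix y assume "y \<in> {d. d dvd p ^ v * m}"
  then obtain a b where ab: "y = a * b" "a dvd p ^ v" "b dvd m"
    using division_decomp by blast
  obtain i where "i \<le> v" "a = p ^ i" using ab(2) assms(1) divides_primepow_nat by blast
  thus "\<exists>x\<in>{..v} \<times> {d. d dvd m}. y = (case x of (i, d) \<Rightarrow> p ^ i * d)"
    using ab by (intro bexI[of _ "(i, b)"]) auto
qed

text \<open>Locally, Dirichlet convolution is the Cauchy product of Bell series. This reduces the
  factorisation f = h * g to a power series identity at each prime.\<close>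

lemma mult_ext_convolution:
  fixes u w :: "nat \<Rightarrow> nat \<Rightarrow> 'a::comm_semiring_1"
  assumes "n > 0" and u0: "\<And>p. u p 0 = 1" and w0: "\<And>p. w p 0 = 1"
  shows "(\<Sum>d | d dvd n. mult_ext u d * mult_ext w (n div d))
       = mult_ext (\<lambda>p v. \<Sum>i\<le>v. u p i * w p (v - i)) n"
  using \<open>n > 0\<close>
proof (induction n rule: prime_power_mult_induct)
  case one
  show ?case by simp
next
  case (mult p v m)
  let ?c = "\<lambda>p v. \<Sum>i\<le>v. u p i * w p (v - i)"
  have "(\<Sum>d | d dvd p ^ v * m. mult_ext u d * mult_ext w (p ^ v * m div d))
      = (\<Sum>(i, d)\<in>{..v} \<times> {d. d dvd m}.
           mult_ext u (p ^ i * d) * mult_ext w (p ^ v * m div (p ^ i * d)))"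
    by (subst sum.reindex_bij_betw[OF divisors_prime_power_mult, symmetric])
       (use mult in \<open>auto simp: case_prod_unfold\<close>)
  also have "\<dots> = (\<Sum>(i, d)\<in>{..v} \<times> {d. d dvd m}.
           (u p i * w p (v - i)) * (mult_ext u d * mult_ext w (m div d)))"
  proof (intro sum.cong refl, clarsimp)
    fix i d assume id: "i \<le> v" "d dvd m"
    then obtain e where e: "m = d * e" by blast
    have pos: "d > 0" "e > 0" "\<not> p dvd d" "\<not> p dvd e" using mult e by auto
    have "p ^ v * m = (p ^ i * d) * (p ^ (v - i) * e)"
      using id e by (simp add: power_add[symmetric] mult_ac)
    hence "p ^ v * m div (p ^ i * d) = p ^ (v - i) * e"
      using pos mult by (simp add: prime_gt_0_nat)
    moreover have "m div d = e" using e pos by simp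
    ultimately show "mult_ext u (p ^ i * d) * mult_ext w (p ^ v * m div (p ^ i * d))
       = u p i * w p (v - i) * (mult_ext u d * mult_ext w (m div d))"
      using mult_ext_prime_power_mult[of p d u i] mult_ext_prime_power_mult[of p e w "v - i"]
        pos mult u0 w0 by (simp add: mult_ac)
  qed
  also have "\<dots> = ?c p v * (\<Sum>d | d dvd m. mult_ext u d * mult_ext w (m div d))"
    by (simp add: sum_product sum.cartesian_product case_prod_unfold)
  also have "\<dots> = ?c p v * mult_ext ?c m" using mult by simp
  also have "\<dots> = mult_ext ?c (p ^ v * m)"
    using mult u0 w0 by (subst mult_ext_prime_power_mult) auto
  finally show ?case .
qed

text \<open>The set \<open>D\<close> lets one interchange serve for primes up to a bound, for all
  primes and for all divisors.\<close>

lemma sum_divisors_swap: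
  fixes F :: "nat \<Rightarrow> nat \<Rightarrow> 'a::comm_monoid_add"
  shows "(\<Sum>n=1..N. \<Sum>d | d \<in> D \<and> d dvd n. F d (n div d))
       = (\<Sum>d\<in>D \<inter> {1..N}. \<Sum>m=1..N div d. F d m)"
proof -
  have "(\<Sum>n=1..N. \<Sum>d | d \<in> D \<and> d dvd n. F d (n div d))
      = (\<Sum>(n, d)\<in>(SIGMA n:{1..N}. {d. d \<in> D \<and> d dvd n}). F d (n div d))"
    by (subst sum.Sigma) (auto intro!: finite_subset[OF _ finite_divisors_nat])
  also have "\<dots> = (\<Sum>(d, m)\<in>(SIGMA d:D \<inter> {1..N}. {1..N div d}). F d m)"
  proof (rule sum.reindex_bij_witness[where j = "\<lambda>(n, d). (d, n div d)" and i = "\<lambda>(d, m). (d * m, d)"])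
    fix x assume x: "x \<in> (SIGMA n:{1..N}. {d. d \<in> D \<and> d dvd n})"
    obtain n d where nd: "x = (n, d)" by (cases x)
    have "d > 0" "d \<le> n" "n > 0" "d \<in> D" "d dvd n" "n \<le> N"
      using x by (auto simp: nd dvd_imp_le intro!: Nat.gr0I)
    thus "(case (case x of (n, d) \<Rightarrow> (d, n div d)) of (d, m) \<Rightarrow> (d * m, d)) = x"
      "(case x of (n, d) \<Rightarrow> (d, n div d)) \<in> (SIGMA d:D \<inter> {1..N}. {1..N div d})"
      "(case case x of (n, d) \<Rightarrow> (d, n div d) of (d, m) \<Rightarrow> F d m) = (case x of (n, d) \<Rightarrow> F d (n div d))"
      unfolding nd by (auto simp: div_le_mono Suc_le_eq div_greater_zero_iff)
  next
    fix y assume "y \<in> (SIGMA d:D \<inter> {1..N}. {1..N div d})"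
    thus "(case (case y of (d, m) \<Rightarrow> (d * m, d)) of (n, d) \<Rightarrow> (d, n div d)) = y"
      "(case y of (d, m) \<Rightarrow> (d * m, d)) \<in> (SIGMA n:{1..N}. {d. d \<in> D \<and> d dvd n})"
      by (auto simp: less_eq_div_iff_mult_less_eq mult.commute)
  qed
  also have "\<dots> = (\<Sum>d\<in>D \<inter> {1..N}. \<Sum>m=1..N div d. F d m)"
    by (subst sum.Sigma) auto
  finally show ?thesis .
qed

section \<open>Finite Euler products\<close>

definition bounded_smooth :: "nat set \<Rightarrow> nat \<Rightarrow> nat set" where
  "bounded_smooth P V = {n. n > 0 \<and> prime_factors n \<subseteq> P \<and> (\<forall>p. prime p \<longrightarrow> multiplicity p n \<le> V)}"

lemma bounded_smooth_insert:
  assumes "prime p" "p \<notin> P"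
  shows "bij_betw (\<lambda>(v, m). p ^ v * m) ({..V} \<times> bounded_smooth P V) (bounded_smooth (insert p P) V)"
proof (rule bij_betwI')
  have nd: "\<not> p dvd m" if "m \<in> bounded_smooth P V" for m
    using that assms by (auto simp: bounded_smooth_def in_prime_factors_iff)
  {
    fix x y assume xy: "x \<in> {..V} \<times> bounded_smooth P V" "y \<in> {..V} \<times> bounded_smooth P V"
    show "((case x of (i, d) \<Rightarrow> p ^ i * d) = (case y of (i, d) \<Rightarrow> p ^ i * d)) = (x = y)"
    proof
      assume eq: "(case x of (i, d) \<Rightarrow> p ^ i * d) = (case y of (i, d) \<Rightarrow> p ^ i * d)"
      obtain i d j e where [simp]: "x = (i, d)" "y = (j, e)" by (cases x, cases y) auto
      have "multiplicity p (p ^ i * d) = multiplicity p (p ^ j * e)" using eq by simp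
      hence "i = j" using assms nd xy by (auto simp: multiplicity_mult_prime_power_self)
      thus "x = y" using eq assms by (auto simp: prime_gt_0_nat)
    qed simp
  }
  {
    fix x assume x: "x \<in> {..V} \<times> bounded_smooth P V"
    obtain v m where [simp]: "x = (v, m)" by (cases x)
    have m: "m > 0" "prime_factors m \<subseteq> P" "\<And>q. prime q \<Longrightarrow> multiplicity q m \<le> V" "v \<le> V"
      using x by (auto simp: bounded_smooth_def)
    have "multiplicity q (p ^ v * m) \<le> V" if "prime q" for q
      using that m nd[of m] x assms(1)
      by (cases "q = p")
         (auto simp: multiplicity_mult_prime_power_self multiplicity_mult_prime_power_other)
    moreover have "prime_factors (p ^ v * m) \<subseteq> insert p P"
    proof
      fix q assume "q \<in> prime_factors (p ^ v * m)"
      hence "prime q" "q dvd p ^ v \<or> q dvd m" by (auto simp: in_prime_factors_iff prime_dvd_mult_iff)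
      thus "q \<in> insert p P"
        using m assms(1) by (metis in_mono in_prime_factors_iff insertCI prime_dvd_power
            primes_dvd_imp_eq zero_less_iff_neq_zero)
    qed
    ultimately show "(case x of (i, d) \<Rightarrow> p ^ i * d) \<in> bounded_smooth (insert p P) V"
      using m assms by (auto simp: bounded_smooth_def prime_gt_0_nat)
  }
  {
    fix n assume n: "n \<in> bounded_smooth (insert p P) V"
    hence nz: "n \<noteq> 0" "\<not> is_unit p" using assms by (auto simp: bounded_smooth_def prime_gt_1_nat)
    obtain m where m: "n = p ^ multiplicity p n * m" "\<not> p dvd m"
      using multiplicity_decompose'[OF nz] by metis
    have m0: "m > 0" using m nz by (cases m) auto
    have "multiplicity q m \<le> V" if "prime q" for q
    proof (cases "q = p")
      case True
      thus ?thesis using m by (simp add: not_dvd_imp_multiplicity_0)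
    next
      case False
      hence "multiplicity q n = multiplicity q m"
        by (subst m(1)) (use assms that m0 in \<open>auto simp: multiplicity_mult_prime_power_other\<close>)
      thus ?thesis using n that by (auto simp: bounded_smooth_def)
    qed
    moreover have "prime_factors m \<subseteq> P"
    proof
      fix q assume q: "q \<in> prime_factors m"
      hence "prime q" "q dvd m" by (auto simp: in_prime_factors_iff)
      hence "q dvd n" "q \<noteq> p" using m by (metis dvd_mult) (use m \<open>q dvd m\<close> in auto)
      thus "q \<in> P" using n nz \<open>prime q\<close> by (auto simp: bounded_smooth_def in_prime_factors_iff)
    qed
    ultimately have "m \<in> bounded_smooth P V" using m0 by (auto simp: bounded_smooth_def)
    moreover have "multiplicity p n \<le> V" using n assms by (auto simp: bounded_smooth_def)
    ultimately show "\<exists>x\<in>{..V} \<times> bounded_smooth P V. n = (case x of (v, m) \<Rightarrow> p ^ v * m)"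
      using m(1) by (intro bexI[of _ "(multiplicity p n, m)"]) auto
  }
qed

text \<open>Capping exponents at \<open>V\<close> makes both sides finite, so the identity is purely
  algebraic and holds over any commutative semiring. The caps used below are 1, giving squarefree
  numbers, and \<open>N\<close>, which reaches every n up to \<open>N\<close>.\<close>

lemma euler_product_finite:
  fixes u :: "nat \<Rightarrow> nat \<Rightarrow> 'a::comm_semiring_1"
  assumes "finite P" "\<And>p. p \<in> P \<Longrightarrow> prime p" and u0: "\<And>p. u p 0 = 1"
  shows "finite (bounded_smooth P V)
       \<and> (\<Sum>n\<in>bounded_smooth P V. mult_ext u n) = (\<Prod>p\<in>P. \<Sum>v\<le>V. u p v)"
  using assms(1,2)
proof (induction P)
  case empty
  have "bounded_smooth {} V = {1}"
    by (auto simp: bounded_smooth_def prime_factorization_empty_iff)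
  thus ?case by simp
next
  case (insert p P)
  have pp: "prime p" and IH: "finite (bounded_smooth P V)"
    "(\<Sum>n\<in>bounded_smooth P V. mult_ext u n) = (\<Prod>p\<in>P. \<Sum>v\<le>V. u p v)"
    using insert by auto
  note bij = bounded_smooth_insert[OF pp insert.hyps(2), of V]
  have "(\<Sum>n\<in>bounded_smooth (insert p P) V. mult_ext u n)
      = (\<Sum>(v, m)\<in>{..V} \<times> bounded_smooth P V. mult_ext u (p ^ v * m))"
    by (subst sum.reindex_bij_betw[OF bij, symmetric]) (simp add: case_prod_unfold)
  also have "\<dots> = (\<Sum>(v, m)\<in>{..V} \<times> bounded_smooth P V. u p v * mult_ext u m)"
  proof (intro sum.cong refl, clarsimp)
    fix v m assume "m \<in> bounded_smooth P V"
    hence "m > 0" "\<not> p dvd m" using pp insert.hyps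
      by (auto simp: bounded_smooth_def in_prime_factors_iff)
    thus "mult_ext u (p ^ v * m) = u p v * mult_ext u m"
      using pp u0 by (simp add: mult_ext_prime_power_mult)
  qed
  also have "\<dots> = (\<Sum>v\<le>V. u p v) * (\<Sum>m\<in>bounded_smooth P V. mult_ext u m)"
    by (simp add: sum_product sum.cartesian_product case_prod_unfold)
  finally show ?case using IH insert.hyps bij by (auto dest: bij_betw_finite)
qed

lemma sum_mult_ext_le_prod:
  fixes u :: "nat \<Rightarrow> nat \<Rightarrow> real"
  assumes u0: "\<And>p. u p 0 = 1" and nn: "\<And>p v. prime p \<Longrightarrow> u p v \<ge> 0"
  shows "(\<Sum>n=1..N. mult_ext u n) \<le> (\<Prod>p | prime p \<and> p \<le> N. \<Sum>v\<le>N. u p v)"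
proof -
  let ?P = "{p. prime p \<and> p \<le> N}"
  have fin: "finite ?P" and pr: "\<And>p. p \<in> ?P \<Longrightarrow> prime p"
    by auto
  note E = euler_product_finite[of ?P u N, OF fin pr u0, THEN conjunct1]
    euler_product_finite[of ?P u N, OF fin pr u0, THEN conjunct2]
  have "{1..N} \<subseteq> bounded_smooth ?P N"
  proof
    fix n assume n: "n \<in> {1..N}"
    have "multiplicity p n \<le> N" if p: "prime p" for p
    proof -
      \<comment> \<open>The inequality v < p^v turns the size of the prime power into a bound on its
        exponent.\<close>
      have "p ^ multiplicity p n \<le> n" using n by (intro dvd_imp_le multiplicity_dvd) auto
      moreover have "multiplicity p n < p ^ multiplicity p n"
        using p by (intro power_gt_expt) (auto simp: prime_gt_Suc_0_nat)
      ultimately show ?thesis using n by auto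
    qed
    thus "n \<in> bounded_smooth ?P N"
      using n by (auto simp: bounded_smooth_def in_prime_factors_iff dest!: dvd_imp_le)
  qed
  hence "(\<Sum>n=1..N. mult_ext u n) \<le> (\<Sum>n\<in>bounded_smooth ?P N. mult_ext u n)"
    using E(1) nn by (intro sum_mono2) (auto intro: mult_ext_nonneg)
  thus ?thesis using E(2) by simp
qed

section \<open>Sums over primes\<close>

lemma sum_powr_le:
  fixes s :: real
  assumes "s > 1"
  shows "(\<Sum>n=1..R. real n powr - s) \<le> 1 + 1 / (s - 1)"
proof -
  \<comment> \<open>The subtracted term makes the induction telescope: n^(-s) is at most the drop of
    m^(1-s) / (s-1) from m = n-1 to m = n. It is discarded at the end.\<close>
  have "(\<Sum>n=1..Suc R. real n powr - s) \<le> 1 + (1 - real (Suc R) powr (1 - s)) / (s - 1)" for R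
  proof (induction R)
    case (Suc R)
    define m n where mn: "m = real (Suc R)" "n = real (Suc (Suc R))"
    have pos: "m > 0" "n > 0" "n = m + 1" by (auto simp: mn)
    have "ln (n / m) = - ln (m / n)" using pos(1,2) by (simp add: ln_div)
    also have "- ln (m / n) \<ge> 1 - m / n" using ln_le_minus_one[of "m / n"] pos(1,2) by simp
    also have "1 - m / n = 1 / n" using pos by (simp add: field_simps)
    finally have l: "ln (n / m) \<ge> 1 / n" .
    have "1 + (s - 1) / n \<le> 1 + (s - 1) * ln (n / m)"
      using mult_left_mono[OF l, of "s - 1"] assms by simp
    also have "\<dots> \<le> exp ((s - 1) * ln (n / m))" by (rule exp_ge_add_one_self)
    also have "\<dots> = (n / m) powr (s - 1)" using pos(1,2) by (simp add: powr_def)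
    finally have "(1 + (s - 1) / n) * n powr (1 - s) \<le> (n / m) powr (s - 1) * n powr (1 - s)"
      by (intro mult_right_mono) auto
    also have "\<dots> = m powr (1 - s)"
      using pos(1,2) by (simp add: powr_divide powr_diff)
    finally have "n powr (1 - s) + (s - 1) * (n powr (1 - s) / n) \<le> m powr (1 - s)"
      by (simp add: algebra_simps)
    also have "n powr (1 - s) / n = n powr - s"
      using powr_diff[of n "1 - s" 1] pos(1,2) by simp
    finally have "n powr - s \<le> (m powr (1 - s) - n powr (1 - s)) / (s - 1)"
      using assms by (simp add: pos_le_divide_eq algebra_simps)
    moreover have "(\<Sum>n=1..Suc (Suc R). real n powr - s) = (\<Sum>n=1..Suc R. real n powr - s) + n powr - s"
      by (subst sum.cl_ivl_Suc) (simp add: mn)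
    ultimately show ?case using Suc.IH by (simp add: diff_divide_distrib mn)
  qed simp
  from this[of "R - 1"] have "(\<Sum>n=1..R. real n powr - s) \<le> 1 + (1 - real R powr (1 - s)) / (s - 1)" if "R > 0"
    using that by simp
  also have "\<dots> \<le> 1 + 1 / (s - 1)" using assms by (simp add: divide_right_mono)
  finally have "(\<Sum>n=1..R. real n powr - s) \<le> 1 + 1 / (s - 1)" if "R > 0" using that .
  thus ?thesis using assms by (cases "R = 0") auto
qed

text \<open>The product of 1 + p^(-s) is a sum over squarefree numbers, hence at most the zeta bound
  1 + 1/(s-1). Taking logarithms gives the prime sum; exponent cap 1 avoids geometric
  series.\<close>

lemma sum_prime_powr_le:
  fixes s :: real
  assumes "s > 1"
  shows "(\<Sum>p | prime p \<and> p \<le> N. real p powr - s) \<le> ln (1 + 1 / (s - 1)) + 2"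
proof -
  let ?P = "{p::nat. prime p \<and> p \<le> N}"
  define u where "u = (\<lambda>(p::nat) (v::nat). (1::real) * (real p powr - s) ^ v)"
  have fin: "finite ?P" and pr: "\<And>p. p \<in> ?P \<Longrightarrow> prime p" and u0: "\<And>p. u p 0 = 1"
    by (auto simp: u_def)
  note E = euler_product_finite[of ?P u 1, OF fin pr u0]
  have u1: "mult_ext u n = real n powr - s" if "n > 0" for n
    using mult_ext_mult_powr[OF that, of "\<lambda>_ _. 1" "-s"] by (simp add: u_def mult_ext_def)
  have "(\<Prod>p\<in>?P. 1 + real p powr - s) = (\<Prod>p\<in>?P. \<Sum>v\<le>1. u p v)"
    by (simp add: u_def)
  also have "\<dots> = (\<Sum>n\<in>bounded_smooth ?P 1. mult_ext u n)" using E by (rule conjunct2[THEN sym])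
  also have "\<dots> = (\<Sum>n\<in>bounded_smooth ?P 1. real n powr - s)"
    by (intro sum.cong refl u1) (auto simp: bounded_smooth_def)
  also have "\<dots> \<le> (\<Sum>n=1..Max (bounded_smooth ?P 1). real n powr - s)"
    using conjunct1[OF E] by (intro sum_mono2) (auto simp: bounded_smooth_def Suc_le_eq)
  also have "\<dots> \<le> 1 + 1 / (s - 1)" by (rule sum_powr_le[OF assms])
  finally have prod: "(\<Prod>p\<in>?P. 1 + real p powr - s) \<le> 1 + 1 / (s - 1)" .
  \<comment> \<open>By x - x^2 <= ln (1 + x), each logarithm loses at most p^(-2s) <= p^(-2). These
    losses total at most 2, the additive constant of the lemma.\<close>
  have "(\<Sum>p\<in>?P. real p powr - s) \<le> (\<Sum>p\<in>?P. ln (1 + real p powr - s) + real p powr - 2)"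
  proof (intro sum_mono)
    fix p assume "p \<in> ?P"
    hence p: "p \<ge> 1" using prime_ge_1_nat by blast
    have "real p powr - s \<le> real p powr 0" using p assms by (intro powr_mono) auto
    hence "real p powr - s - (real p powr - s)\<^sup>2 \<le> ln (1 + real p powr - s)"
      using p by (intro ln_one_plus_pos_lower_bound) auto
    moreover have "(real p powr - s)\<^sup>2 = real p powr (- (2 * s))"
      using p by (simp add: power2_eq_square powr_add[symmetric])
    moreover have "real p powr (- (2 * s)) \<le> real p powr - 2"
      using p assms by (intro powr_mono) auto
    ultimately show "real p powr - s \<le> ln (1 + real p powr - s) + real p powr - 2" by linarith
  qed
  also have "\<dots> = ln (\<Prod>p\<in>?P. 1 + real p powr - s) + (\<Sum>p\<in>?P. real p powr - 2)"
  proof -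
    have "1 + real p powr - s \<noteq> 0" for p by (smt (verit) powr_ge_zero)
    thus ?thesis by (subst ln_prod) (auto simp: sum.distrib)
  qed
  also have "ln (\<Prod>p\<in>?P. 1 + real p powr - s) \<le> ln (1 + 1 / (s - 1))"
    using prod by (intro ln_mono prod_pos) (auto simp: add_pos_nonneg)
  also have "(\<Sum>p\<in>?P. real p powr - 2) \<le> (\<Sum>n=1..N. real n powr - 2)"
    by (intro sum_mono2) (auto simp: prime_ge_Suc_0_nat)
  also have "\<dots> \<le> 1 + 1 / (2 - 1)" by (rule sum_powr_le) auto
  finally show ?thesis by simp
qed

section \<open>The logarithmic mean of the majorant\<close>

lemma sum_power_over_fact_le:
  fixes x :: real
  assumes "x \<ge> 0"
  shows "(\<Sum>v\<le>N. x ^ v / fact v) \<le> exp x"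
proof -
  have "(\<Sum>v\<le>N. x ^ v / fact v) \<le> (\<Sum>v. x ^ v / fact v)"
    using assms summable_exp[of x] by (intro sum_le_suminf) (auto simp: field_simps)
  thus ?thesis by (simp add: exp_def divide_inverse scaleR_conv_of_real mult.commute)
qed

text \<open>The local factor at p is at most exp (k p^(-s)), so the Euler product is at most the
  exponential of k times a prime sum. The choice s - 1 = 1 / ln N makes that prime sum at most ln (1
  + ln N) + 2.\<close>

lemma sum_mult_ext_power_over_fact_le:
  fixes k :: real
  assumes "k \<ge> 0" "N \<ge> 1"
  shows "(\<Sum>n=1..N. mult_ext (\<lambda>p v. k ^ v / fact v) n / real n) \<le> exp (1 + 2 * k) * (1 + ln (real N)) powr k"
proof (cases "N = 1")
  case True
  thus ?thesis using assms by simp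
next
  case False
  hence N: "N \<ge> 2" using assms by simp
  \<comment> \<open>Rankin's trick: \<open>1 / n \<le> exp 1 * n powr - s\<close> for \<open>n \<le> N\<close>.\<close>
  define s where "s = 1 + 1 / ln (real N)"
  have s: "s > 1" using N by (simp add: s_def)
  let ?u = "\<lambda>(p::nat) v. k ^ v / fact v * (real p powr - s) ^ v"
  have "(\<Sum>n=1..N. mult_ext (\<lambda>p v. k ^ v / fact v) n / real n)
      \<le> (\<Sum>n=1..N. exp 1 * mult_ext ?u n)"
  proof (intro sum_mono)
    fix n assume n: "n \<in> {1..N}"
    have "real n powr (1 / ln (real N)) \<le> real N powr (1 / ln (real N))"
      using n N by (intro powr_mono2) auto
    also have "\<dots> = exp 1" using N by (simp add: powr_def)
    finally have "real n powr (1 / ln (real N)) * real n powr - s \<le> exp 1 * real n powr - s"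
      by (intro mult_right_mono) auto
    moreover have "real n powr (1 / ln (real N)) * real n powr - s = 1 / real n"
      using n by (simp add: s_def powr_add[symmetric] powr_minus divide_inverse)
    ultimately have "1 / real n \<le> exp 1 * real n powr - s" by simp
    from mult_left_mono[OF this, of "mult_ext (\<lambda>p v. k ^ v / fact v) n"]
    show "mult_ext (\<lambda>p v. k ^ v / fact v) n / real n \<le> exp 1 * mult_ext ?u n"
      using n assms by (subst mult_ext_mult_powr) (auto simp: mult_ext_nonneg mult_ac)
  qed
  also have "\<dots> = exp 1 * (\<Sum>n=1..N. mult_ext ?u n)" by (simp add: sum_distrib_left)
  also have "(\<Sum>n=1..N. mult_ext ?u n) \<le> (\<Prod>p | prime p \<and> p \<le> N. \<Sum>v\<le>N. ?u p v)"
    using assms by (intro sum_mult_ext_le_prod) auto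
  also have "\<dots> \<le> (\<Prod>p | prime p \<and> p \<le> N. exp (k * real p powr - s))"
  proof (intro prod_mono conjI)
    fix p
    have "(\<Sum>v\<le>N. ?u p v) = (\<Sum>v\<le>N. (k * real p powr - s) ^ v / fact v)"
      by (simp add: power_mult_distrib)
    also have "\<dots> \<le> exp (k * real p powr - s)" using assms by (intro sum_power_over_fact_le) auto
    finally show "(\<Sum>v\<le>N. ?u p v) \<le> exp (k * real p powr - s)" .
  qed (use assms in \<open>auto intro!: sum_nonneg\<close>)
  also have "\<dots> = exp (k * (\<Sum>p | prime p \<and> p \<le> N. real p powr - s))"
    by (simp add: exp_sum sum_distrib_left)
  also have "\<dots> \<le> exp (k * (ln (1 + 1 / (s - 1)) + 2))"
    using assms sum_prime_powr_le[OF s] by (simp add: mult_left_mono)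
  also have "1 + 1 / (s - 1) = 1 + ln (real N)" using N by (simp add: s_def)
  also have "exp 1 * exp (k * (ln (1 + ln (real N)) + 2)) = exp (1 + 2 * k) * (1 + ln (real N)) powr k"
  proof -
    have "1 + ln (real N) > 0" using N by (simp add: add_pos_nonneg)
    thus ?thesis by (simp add: powr_def exp_add[symmetric] algebra_simps)
  qed
  finally show ?thesis by simp
qed

section \<open>An upper bound of Mertens type\<close>

lemma ln_eq_sum_multiplicity:
  fixes n :: nat
  assumes "n > 0"
  shows "ln (real n) = (\<Sum>p | prime p \<and> p dvd n. real (multiplicity p n) * ln (real p))"
proof -
  have "ln (real n) = ln (\<Prod>p\<in>prime_factors n. real p ^ multiplicity p n)"
    using arg_cong[OF prime_factorization_nat[OF assms], of real] by (simp only: of_nat_prod of_nat_power)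
  also have "\<dots> = (\<Sum>p\<in>prime_factors n. ln (real p ^ multiplicity p n))"
    by (intro ln_prod) (auto simp: prime_factors_gt_0_nat)
  also have "\<dots> = (\<Sum>p\<in>prime_factors n. real (multiplicity p n) * ln (real p))"
    by (intro sum.cong refl ln_realpow)
  finally show ?thesis using assms by (simp add: prime_factors_dvd)
qed

text \<open>
  No Chebyshev bound is needed: up to \<open>z\<^sup>2\<close>, the sum of \<open>ln n / n\<close> dominates the product of the sum of
  \<open>ln p / p\<close> over primes up to \<open>z\<close> with the harmonic number of \<open>z\<close>.
\<close>

lemma sum_ln_prime_over_prime_le:
  fixes z :: nat
  assumes "z \<ge> 1"
  shows "(\<Sum>p | prime p \<and> p \<le> z. ln (real p) / real p) \<le> 2 + 4 * ln (real z)"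
proof (cases "z = 1")
  case True
  hence "{p. prime p \<and> p \<le> z} = {}" by (auto dest!: prime_ge_2_nat)
  thus ?thesis using True by (simp only: sum.empty) simp
next
  case False
  hence z: "z \<ge> 2" using assms by simp
  define D where "D = {p. prime p \<and> p \<le> z}"
  have D: "D \<inter> {1..z^2} = D"
    using self_le_power[of z 2] z by (auto simp: D_def prime_ge_Suc_0_nat)
  let ?F = "\<lambda>p m. ln (real p) / (real p * real m)"
  have "(\<Sum>p\<in>D. ln (real p) / real p) * ln (real z) \<le> (\<Sum>p\<in>D. ln (real p) / real p * harm z)"
  proof (subst sum_distrib_right, intro sum_mono mult_left_mono)
    have "ln (real z) \<le> ln (real z + 1)" using z by simp
    also have "\<dots> \<le> harm z" using ln_le_harm[of z] by (simp add: add.commute)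
    finally show "ln (real z) \<le> harm z" .
  qed (auto simp: D_def prime_ge_Suc_0_nat intro!: divide_nonneg_nonneg ln_ge_zero)
  also have "\<dots> \<le> (\<Sum>p\<in>D. \<Sum>m=1..z^2 div p. ?F p m)"
  proof (intro sum_mono)
    \<comment> \<open>Since p <= z, every cofactor range up to \<open>z^2 div p\<close> contains
      1..z; this is why the outer sum runs to the square of z.\<close>
    fix p assume p: "p \<in> D"
    hence "z \<le> z\<^sup>2 div p"
      by (auto simp: D_def less_eq_div_iff_mult_less_eq prime_gt_0_nat power2_eq_square)
    hence "(\<Sum>m=1..z. ?F p m) \<le> (\<Sum>m=1..z\<^sup>2 div p. ?F p m)"
      using p by (intro sum_mono2)
        (auto simp: D_def prime_ge_Suc_0_nat intro!: divide_nonneg_nonneg ln_ge_zero)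
    thus "ln (real p) / real p * harm z \<le> (\<Sum>m=1..z\<^sup>2 div p. ?F p m)"
      by (simp add: harm_def sum_distrib_left divide_inverse mult_ac)
  qed
  also have "\<dots> = (\<Sum>n=1..z\<^sup>2. \<Sum>p | p \<in> D \<and> p dvd n. ?F p (n div p))"
    by (subst sum_divisors_swap) (simp only: D)
  also have "\<dots> \<le> (\<Sum>n=1..z\<^sup>2. ln (real (z\<^sup>2)) / real n)"
  proof (intro sum_mono)
    fix n assume n: "n \<in> {1..z\<^sup>2}"
    have fin: "finite {p. prime p \<and> p dvd n}"
      using n by (intro finite_subset[OF _ finite_divisors_nat[of n]]) auto
    have "(\<Sum>p | p \<in> D \<and> p dvd n. ?F p (n div p)) = (\<Sum>p | p \<in> D \<and> p dvd n. ln (real p)) / real n"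
      unfolding sum_divide_distrib
      by (intro sum.cong refl) (auto simp: of_nat_mult[symmetric] simp del: of_nat_mult)
    also have "(\<Sum>p | p \<in> D \<and> p dvd n. ln (real p)) \<le> (\<Sum>p | prime p \<and> p dvd n. ln (real p))"
      using fin by (intro sum_mono2) (auto simp: D_def prime_ge_Suc_0_nat)
    also have "\<dots> \<le> (\<Sum>p | prime p \<and> p dvd n. real (multiplicity p n) * ln (real p))"
    proof (intro sum_mono)
      fix p assume p: "p \<in> {p. prime p \<and> p dvd n}"
      hence "multiplicity p n > 0" using n by (simp add: prime_multiplicity_gt_zero_iff)
      thus "ln (real p) \<le> real (multiplicity p n) * ln (real p)"
        using p mult_right_mono[of 1 "real (multiplicity p n)" "ln (real p)"]
          prime_ge_1_nat[of p] by simp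
    qed
    also have "\<dots> = ln (real n)" using n by (intro ln_eq_sum_multiplicity[symmetric]) auto
    also have "\<dots> \<le> ln (real (z\<^sup>2))" using n z by (subst ln_le_cancel_iff) auto
    finally show "(\<Sum>p | p \<in> D \<and> p dvd n. ?F p (n div p)) \<le> ln (real (z\<^sup>2)) / real n"
      by (simp add: divide_right_mono)
  qed
  also have "\<dots> = ln (real (z\<^sup>2)) * harm (z\<^sup>2)"
    by (simp add: harm_def sum_distrib_left divide_inverse)
  also have "\<dots> \<le> ln (real (z\<^sup>2)) * (1 + ln (real (z\<^sup>2)))"
    using euler_mascheroni_sequence_decreasing[of 1 "z\<^sup>2"] z
    by (intro mult_left_mono) (auto simp: Suc_le_eq harm_def)
  \<comment> \<open>The constants are those of 2 ln z (1 + 2 ln z). The common factor ln z is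
    positive because z >= 2, and is cancelled.\<close>
  also have "\<dots> = (2 + 4 * ln (real z)) * ln (real z)"
    using z by (simp add: ln_realpow algebra_simps)
  finally show ?thesis using z unfolding D_def by (subst (asm) mult_le_cancel_right) auto
qed

section \<open>The exponential multiplicative function with given prime values\<close>

definition exp_mult :: "(nat \<Rightarrow> complex) \<Rightarrow> nat \<Rightarrow> complex" where
  "exp_mult a = mult_ext (\<lambda>p v. a p ^ v / fact v)"

lemma norm_exp_mult_le:
  assumes "\<And>p. prime p \<Longrightarrow> norm (a p) \<le> k"
  shows "norm (exp_mult a n) \<le> mult_ext (\<lambda>p v. k ^ v / fact v) n"
  unfolding exp_mult_def norm_mult_ext using assms
  by (intro mult_ext_mono) (auto simp: norm_divide norm_power intro!: divide_right_mono power_mono)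

lemma sum_norm_exp_mult_over_le:
  assumes "k \<ge> 0" "N \<ge> 1" "\<And>p. prime p \<Longrightarrow> norm (a p) \<le> k"
  shows "(\<Sum>n=1..N. norm (exp_mult a n) / real n) \<le> exp (1 + 2 * k) * (1 + ln (real N)) powr k"
proof -
  have "(\<Sum>n=1..N. norm (exp_mult a n) / real n) \<le> (\<Sum>n=1..N. mult_ext (\<lambda>p v. k ^ v / fact v) n / real n)"
    using assms by (intro sum_mono divide_right_mono norm_exp_mult_le) auto
  thus ?thesis using sum_mult_ext_power_over_fact_le[OF assms(1,2)] by simp
qed

text \<open>The trivial bound. It misses the target by about (log N)^(A+1), so it serves only for
  bounded N or where a power of N is to spare.\<close>

lemma norm_sum_exp_mult_le:
  assumes "k \<ge> 0" "N \<ge> 1" "\<And>p. prime p \<Longrightarrow> norm (a p) \<le> k"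
  shows "norm (\<Sum>n=1..N. exp_mult a n) \<le> exp (1 + 2 * k) * real N * (1 + ln (real N)) powr k"
proof -
  have "norm (\<Sum>n=1..N. exp_mult a n) \<le> (\<Sum>n=1..N. norm (exp_mult a n))" by (rule norm_sum)
  also have "\<dots> \<le> (\<Sum>n=1..N. real N * (norm (exp_mult a n) / real n))"
  proof (intro sum_mono)
    fix n assume n: "n \<in> {1..N}"
    have "norm (exp_mult a n) * 1 \<le> norm (exp_mult a n) * (real N / real n)"
      using n by (intro mult_left_mono) auto
    thus "norm (exp_mult a n) \<le> real N * (norm (exp_mult a n) / real n)" by (simp add: mult_ac)
  qed
  also have "\<dots> = real N * (\<Sum>n=1..N. norm (exp_mult a n) / real n)" by (simp add: sum_distrib_left)
  also have "\<dots> \<le> real N * (exp (1 + 2 * k) * (1 + ln (real N)) powr k)"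
    using sum_norm_exp_mult_over_le[OF assms] by (intro mult_left_mono) auto
  finally show ?thesis by (simp add: mult_ac)
qed

text \<open>Because v * a^v / v! = a * a^(v-1) / (v-1)!, weighting by the multiplicity strips off
  one factor p. The factorials in \<open>exp_mult\<close> exist for this cancellation, which
  confines the logarithmic identity to primes.\<close>

lemma exp_mult_mult_multiplicity:
  assumes "prime p" "p dvd n" "n > 0"
  shows "exp_mult a n * of_nat (multiplicity p n) = a p * exp_mult a (n div p)"
proof -
  have nz: "n \<noteq> 0" "\<not> is_unit p" using assms by (auto simp: prime_gt_1_nat)
  obtain m where m: "n = p ^ multiplicity p n * m" "\<not> p dvd m"
    using multiplicity_decompose'[OF nz] by metis
  have m0: "m > 0" using m nz by (cases m) auto
  have "multiplicity p n > 0" using assms by (simp add: prime_multiplicity_gt_zero_iff)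
  then obtain v where v: "multiplicity p n = Suc v" by (cases "multiplicity p n") auto
  have n: "n = p ^ Suc v * m" using m(1) v by simp
  have "n div p = p ^ v * m" using assms by (simp add: n prime_gt_0_nat)
  moreover have "exp_mult a (p ^ w * m) = a p ^ w / fact w * exp_mult a m" for w
    unfolding exp_mult_def using assms m m0 by (intro mult_ext_prime_power_mult) auto
  ultimately show ?thesis unfolding v by (simp only: n) (simp add: field_simps del: of_nat_Suc)
qed

lemma exp_mult_mult_ln:
  assumes "n > 0"
  shows "exp_mult a n * of_real (ln (real n))
       = (\<Sum>p | p \<in> {p. prime p} \<and> p dvd n. a p * of_real (ln (real p)) * exp_mult a (n div p))"
proof -
  have "exp_mult a n * of_real (ln (real n))
      = (\<Sum>p | prime p \<and> p dvd n. (exp_mult a n * of_nat (multiplicity p n)) * of_real (ln (real p)))"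
    by (subst ln_eq_sum_multiplicity[OF assms]) (simp add: sum_distrib_left mult_ac)
  also have "\<dots> = (\<Sum>p | prime p \<and> p dvd n. (a p * exp_mult a (n div p)) * of_real (ln (real p)))"
    using assms by (intro sum.cong refl) (auto simp: exp_mult_mult_multiplicity)
  finally show ?thesis by (simp add: mult_ac)
qed

section \<open>Summation identities for the inductive step\<close>

lemma sum_exp_mult_ln:
  "(\<Sum>n=1..N. exp_mult a n * of_real (ln (real n)))
     = (\<Sum>p\<in>{p. prime p} \<inter> {1..N}. \<Sum>m=1..N div p. a p * of_real (ln (real p)) * exp_mult a m)"
proof -
  have "(\<Sum>n=1..N. exp_mult a n * of_real (ln (real n)))
      = (\<Sum>n=1..N. \<Sum>p | p \<in> {p. prime p} \<and> p dvd n. a p * of_real (ln (real p)) * exp_mult a (n div p))"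
    by (intro sum.cong refl exp_mult_mult_ln) auto
  also have "\<dots> = (\<Sum>p\<in>{p. prime p} \<inter> {1..N}. \<Sum>m=1..N div p. a p * of_real (ln (real p)) * exp_mult a m)"
    by (rule sum_divisors_swap)
  finally show ?thesis .
qed

text \<open>Summation by parts. The weight vanishes at n = N, so only partial sums at arguments
  below \<open>N\<close> occur, exactly those that an induction on \<open>N\<close>
  controls.\<close>

lemma sum_mult_ln_diff:
  fixes g :: "nat \<Rightarrow> complex"
  shows "(\<Sum>n=1..N. g n * of_real (ln (real N) - ln (real n)))
       = (\<Sum>n\<in>{1..<N}. (\<Sum>m=1..n. g m) * of_real (ln (real (Suc n)) - ln (real n)))"
proof (induction N)
  case (Suc N)
  have "(\<Sum>n=1..Suc N. g n * of_real (ln (real (Suc N)) - ln (real n)))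
      = (\<Sum>n=1..N. g n * of_real (ln (real (Suc N)) - ln (real n)))" by simp
  also have "\<dots> = (\<Sum>n=1..N. g n * of_real (ln (real N) - ln (real n)))
      + (\<Sum>n=1..N. g n) * of_real (ln (real (Suc N)) - ln (real N))"
    by (simp only: sum_distrib_right sum.distrib[symmetric]) (intro sum.cong refl, simp add: algebra_simps)
  finally show ?case using Suc by (cases N) auto
qed simp

text \<open>Pairs with d <= Z keep the inner sum over m; for the others the order is exchanged,
  leaving d in the range from Z (exclusive) to \<open>N div m\<close>. The conditional is needed
  because that range is empty when \<open>N div m < Z\<close>, whereas the difference of partial
  sums need not vanish.\<close>

lemma hyperbola_split:
  fixes c g :: "nat \<Rightarrow> complex"
  assumes "Z \<le> N"
  shows "(\<Sum>d\<in>D \<inter> {1..N}. \<Sum>m=1..N div d. c d * g m)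
       = (\<Sum>d\<in>D \<inter> {1..Z}. c d * (\<Sum>m=1..N div d. g m))
       + (\<Sum>m=1..N. g m * (if Z \<le> N div m then (\<Sum>d\<in>D \<inter> {1..N div m}. c d) - (\<Sum>d\<in>D \<inter> {1..Z}. c d) else 0))"
proof -
  have "D \<inter> {1..N} = (D \<inter> {1..Z}) \<union> (D \<inter> {Z<..N})" using assms by auto
  hence "(\<Sum>d\<in>D \<inter> {1..N}. \<Sum>m=1..N div d. c d * g m)
       = (\<Sum>d\<in>D \<inter> {1..Z}. \<Sum>m=1..N div d. c d * g m)
       + (\<Sum>d\<in>D \<inter> {Z<..N}. \<Sum>m=1..N div d. c d * g m)"
    by (simp only:) (intro sum.union_disjoint; auto)
  also have "(\<Sum>d\<in>D \<inter> {Z<..N}. \<Sum>m=1..N div d. c d * g m)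
      = (\<Sum>d\<in>D \<inter> {Z<..N}. \<Sum>m | m \<in> {1..N} \<and> d * m \<le> N. c d * g m)"
  proof (intro sum.cong refl)
    fix d assume d: "d \<in> D \<inter> {Z<..N}"
    have "m \<le> N" if "d * m \<le> N" for m
      using order_trans[OF _ that, of m] d by simp
    thus "{1..N div d} = {m. m \<in> {1..N} \<and> d * m \<le> N}"
      using d by (auto simp: less_eq_div_iff_mult_less_eq mult.commute)
  qed
  also have "\<dots> = (\<Sum>m=1..N. \<Sum>d | d \<in> D \<inter> {Z<..N} \<and> d * m \<le> N. c d * g m)"
    by (rule sum.swap_restrict) auto
  also have "\<dots> = (\<Sum>m=1..N. g m * (if Z \<le> N div m then (\<Sum>d\<in>D \<inter> {1..N div m}. c d) - (\<Sum>d\<in>D \<inter> {1..Z}. c d) else 0))"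
  proof (intro sum.cong refl)
    fix m assume m: "m \<in> {1..N}"
    have "d \<le> N" if "d * m \<le> N" for d
      using order_trans[OF _ that, of d] m by simp
    moreover have "N div m \<le> N" by (rule div_le_dividend)
    ultimately have "{d. d \<in> D \<inter> {Z<..N} \<and> d * m \<le> N} = D \<inter> {Z<..N div m}"
      using m by (auto simp: less_eq_div_iff_mult_less_eq)
    hence "(\<Sum>d | d \<in> D \<inter> {Z<..N} \<and> d * m \<le> N. c d * g m) = g m * (\<Sum>d\<in>D \<inter> {Z<..N div m}. c d)"
      by (simp add: sum_distrib_left mult.commute)
    also have "(\<Sum>d\<in>D \<inter> {Z<..N div m}. c d)
        = (if Z \<le> N div m then (\<Sum>d\<in>D \<inter> {1..N div m}. c d) - (\<Sum>d\<in>D \<inter> {1..Z}. c d) else 0)"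
    proof (cases "Z \<le> N div m")
      case True
      hence "D \<inter> {1..N div m} = (D \<inter> {1..Z}) \<union> (D \<inter> {Z<..N div m})" by auto
      hence "(\<Sum>d\<in>D \<inter> {1..N div m}. c d) = (\<Sum>d\<in>D \<inter> {1..Z}. c d) + (\<Sum>d\<in>D \<inter> {Z<..N div m}. c d)"
        by (simp only:) (intro sum.union_disjoint; auto)
      thus ?thesis using True by simp
    qed auto
    finally show "(\<Sum>d | d \<in> D \<inter> {Z<..N} \<and> d * m \<le> N. c d * g m)
      = g m * (if Z \<le> N div m then (\<Sum>d\<in>D \<inter> {1..N div m}. c d) - (\<Sum>d\<in>D \<inter> {1..Z}. c d) else 0)" .
  qed
  finally show ?thesis by (simp add: sum_distrib_left)
qed

text \<open>Rounding down a real number that is at least 2 therefore at most halves its logarithm.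
  This covers both the cut-off \<open>Z\<close> and the passage from real x to integers.\<close>

lemma sqrt_le_floor:
  fixes y :: real
  assumes "y \<ge> 2"
  shows "sqrt y \<le> real (nat \<lfloor>y\<rfloor>)"
proof (cases "y < 3")
  case True
  hence "\<lfloor>y\<rfloor> = 2" using assms by linarith
  moreover have "sqrt y \<le> sqrt (2\<^sup>2)" using True by (intro real_sqrt_le_mono) auto
  ultimately show ?thesis by simp
next
  case False
  have "3 * y \<le> y * y" using False by (intro mult_right_mono) auto
  hence "y * 3 \<le> 1 + y * y" by linarith
  hence "y \<le> (y - 1)\<^sup>2"
    by (simp add: power2_eq_square algebra_simps)
  hence "sqrt y \<le> y - 1" using False by (intro real_le_lsqrt) auto
  moreover have "real (nat \<lfloor>y\<rfloor>) = real_of_int \<lfloor>y\<rfloor>" using False by simp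
  moreover have "real_of_int \<lfloor>y\<rfloor> \<ge> y - 1" by linarith
  ultimately show ?thesis by linarith
qed

text \<open>Here ln y lies between (ln x) / 2 and ln x. The upper end is used for b >= 0 and the
  lower one for b < 0, whence the absolute value in the constant.\<close>

lemma ln_powr_le_of_sqrt_le:
  fixes x y b :: real
  assumes "x > 1" "sqrt x \<le> y" "y \<le> x"
  shows "ln y powr b \<le> 2 powr \<bar>b\<bar> * ln x powr b"
proof -
  have "ln (sqrt x) \<le> ln y" using assms by (subst ln_le_cancel_iff) (auto intro: less_le_trans[of _ "sqrt x"])
  hence l: "ln x / 2 \<le> ln y" "0 < ln x" using assms by (simp_all add: ln_sqrt)
  have y: "y \<ge> 1" using assms by (smt (verit) real_sqrt_ge_one)
  show ?thesis
  proof (cases "b \<ge> 0")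
    case True
    have "ln y powr b \<le> 1 * ln x powr b"
      using True l assms y by (auto intro!: powr_mono2)
    also have "\<dots> \<le> 2 powr \<bar>b\<bar> * ln x powr b"
      by (intro mult_right_mono ge_one_powr_ge_zero) auto
    finally show ?thesis .
  next
    case False
    have "ln y powr b \<le> (ln x / 2) powr b"
      using False l by (intro powr_mono2') auto
    also have "\<dots> = 2 powr \<bar>b\<bar> * ln x powr b"
    proof -
      have "\<bar>b\<bar> = - b" using False by simp
      hence "2 powr \<bar>b\<bar> = inverse (2 powr b)" by (simp add: powr_minus)
      moreover have "(ln x / 2) powr b = ln x powr b / 2 powr b"
        by (rule powr_divide)
      ultimately show ?thesis by (metis divide_inverse mult.commute)
    qed
    finally show ?thesis .
  qed
qed

section \<open>One step of the induction\<close>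

text \<open>The quotient N / d is at least N^(3/4) >= 2 sqrt N >= sqrt N + 1, and rounding down
  loses at most 1. The threshold 16 gives N^(1/4) >= 2.\<close>

lemma sqrt_le_div:
  fixes N d :: nat
  assumes "N \<ge> 16" "d \<ge> 1" "real d \<le> real N powr (1 / 4)"
  shows "sqrt (real N) \<le> real (N div d)"
proof -
  have q: "real N powr (1 / 4) \<ge> 2"
  proof -
    have "(2::real) = (2 powr 4) powr (1 / 4)" by (simp only: powr_powr) simp
    also have "\<dots> \<le> real N powr (1 / 4)" using assms by (intro powr_mono2) auto
    finally show ?thesis .
  qed
  have s: "sqrt (real N) \<ge> 1" using assms by simp
  have "real N = sqrt (real N) * (real N powr (1 / 4) * real N powr (1 / 4))"
    using assms by (simp add: powr_add[symmetric] powr_half_sqrt)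
  hence "real N / real N powr (1 / 4) = sqrt (real N) * real N powr (1 / 4)"
    using q by (metis mult.assoc nonzero_mult_div_cancel_right not_numeral_le_zero)
  moreover have "sqrt (real N) * 2 \<le> sqrt (real N) * real N powr (1 / 4)"
    using q s by (intro mult_left_mono) auto
  moreover have "real N / real N powr (1 / 4) \<le> real N / real d"
    using assms by (intro divide_left_mono) auto
  ultimately have "sqrt (real N) + 1 \<le> real N / real d" using s by linarith
  moreover have "real N / real d \<le> real (N div d) + 1"
  proof -
    have "real N = real (N div d) * real d + real (N mod d)"
      by (metis div_mult_mod_eq of_nat_add of_nat_mult)
    moreover have "N mod d < d" using assms by simp
    ultimately have "real N \<le> (real (N div d) + 1) * real d"
      by (simp add: distrib_right)
    thus ?thesis using assms by (simp add: pos_divide_le_eq)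
  qed
  ultimately show ?thesis by linarith
qed

text \<open>For these small primes \<open>N div p\<close> is at least sqrt N, so its logarithm may
  be replaced by ln N at the cost of \<open>2 powr \<bar>b\<bar>\<close>. What remains is the sum of
  ln p / p up to \<open>Z\<close>.\<close>

lemma norm_prime_part_le:
  fixes a :: "nat \<Rightarrow> complex" and S :: "nat \<Rightarrow> complex"
  assumes "k \<ge> 0" "M \<ge> 0" and N: "N \<ge> 16" and Z: "Z \<ge> 1" "real Z \<le> real N powr (1 / 4)"
    and ak: "\<And>p. prime p \<Longrightarrow> norm (a p) \<le> k"
    and IH: "\<And>n. 2 \<le> n \<Longrightarrow> n < N \<Longrightarrow> norm (S n) \<le> M * real n * ln (real n) powr b"
  shows "norm (\<Sum>p\<in>{p. prime p} \<inter> {1..Z}. a p * of_real (ln (real p)) * S (N div p))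
       \<le> k * M * 2 powr \<bar>b\<bar> * real N * ln (real N) powr b * (2 + 4 * ln (real Z))"
proof -
  let ?X = "k * M * 2 powr \<bar>b\<bar> * real N * ln (real N) powr b"
  have "norm (\<Sum>p\<in>{p. prime p} \<inter> {1..Z}. a p * of_real (ln (real p)) * S (N div p))
      \<le> (\<Sum>p\<in>{p. prime p} \<inter> {1..Z}. ?X * (ln (real p) / real p))"
  proof (intro sum_norm_le)
    fix p assume p: "p \<in> {p. prime p} \<inter> {1..Z}"
    have p2: "p \<ge> 2" using p prime_ge_2_nat by blast
    have sq: "sqrt (real N) \<le> real (N div p)" using N p Z by (intro sqrt_le_div) auto
    have "sqrt 16 \<le> sqrt (real N)" using N by (subst real_sqrt_le_iff) simp
    hence "N div p \<ge> 2" using sq by simp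
    moreover have "N div p < N" using p2 N by simp
    ultimately have "norm (S (N div p)) \<le> M * real (N div p) * ln (real (N div p)) powr b"
      by (rule IH)
    also have "\<dots> \<le> M * (real N / real p) * (2 powr \<bar>b\<bar> * ln (real N) powr b)"
      using sq N \<open>M \<ge> 0\<close> p2
      by (intro mult_mono mult_nonneg_nonneg ln_powr_le_of_sqrt_le of_nat_div_le_of_nat) auto
    finally have 1: "norm (S (N div p)) \<le> M * (real N / real p) * (2 powr \<bar>b\<bar> * ln (real N) powr b)" .
    have "norm (a p * of_real (ln (real p)) * S (N div p)) = norm (a p) * ln (real p) * norm (S (N div p))"
      using p2 by (simp add: norm_mult)
    also have "\<dots> \<le> k * ln (real p) * (M * (real N / real p) * (2 powr \<bar>b\<bar> * ln (real N) powr b))"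
      using 1 p p2 ak assms(1) by (intro mult_mono) auto
    finally show "norm (a p * of_real (ln (real p)) * S (N div p)) \<le> ?X * (ln (real p) / real p)"
      by (simp add: mult_ac)
  qed
  also have "\<dots> = ?X * (\<Sum>p\<in>{p. prime p} \<inter> {1..Z}. ln (real p) / real p)"
    by (simp add: sum_distrib_left)
  also have "\<dots> = ?X * (\<Sum>p | prime p \<and> p \<le> Z. ln (real p) / real p)"
    by (intro arg_cong2[where f = "(*)"] sum.cong refl) (auto simp: prime_ge_Suc_0_nat)
  also have "\<dots> \<le> ?X * (2 + 4 * ln (real Z))"
    using assms by (intro mult_left_mono sum_ln_prime_over_prime_le) auto
  finally show ?thesis .
qed

text \<open>For fixed m the primes fill an interval with both ends at least \<open>Z\<close>. The
  estimate for \<open>E\<close> at the two ends gives the factor 2 and the saving (ln Z)^A; absolute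
  values are taken only over m.\<close>

lemma norm_cofactor_part_le:
  fixes a :: "nat \<Rightarrow> complex" and E :: "nat \<Rightarrow> complex"
  assumes "k \<ge> 0" "C \<ge> 0" "A > 0" "N \<ge> 1" and Z: "Z \<ge> 2"
    and ak: "\<And>p. prime p \<Longrightarrow> norm (a p) \<le> k"
    and E: "\<And>n. n \<ge> 2 \<Longrightarrow> norm (E n) \<le> C * real n / ln (real n) powr A"
  shows "norm (\<Sum>m=1..N. exp_mult a m * (if Z \<le> N div m then E (N div m) - E Z else 0))
       \<le> 2 * C * real N / ln (real Z) powr A * (exp (1 + 2 * k) * (1 + ln (real N)) powr k)"
proof -
  let ?X = "2 * C * real N / ln (real Z) powr A"
  have "norm (\<Sum>m=1..N. exp_mult a m * (if Z \<le> N div m then E (N div m) - E Z else 0))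
      \<le> (\<Sum>m=1..N. ?X * (norm (exp_mult a m) / real m))"
  proof (intro sum_norm_le)
    fix m assume m: "m \<in> {1..N}"
    have E': "norm (E n) \<le> C * (real N / real m) / ln (real Z) powr A" if n: "Z \<le> n" "n \<le> N div m" for n
    proof -
      have "norm (E n) \<le> C * real n / ln (real n) powr A" using E n Z by simp
      also have "\<dots> \<le> C * (real N / real m) / ln (real Z) powr A"
      proof (intro frac_le mult_left_mono powr_mono2)
        show "real n \<le> real N / real m"
          using n of_nat_div_le_of_nat[of N m] by (meson of_nat_le_iff order_trans)
      qed (use n Z assms in auto)
      finally show ?thesis .
    qed
    have "norm (if Z \<le> N div m then E (N div m) - E Z else 0) \<le> 2 * (C * (real N / real m) / ln (real Z) powr A)"
    proof (cases "Z \<le> N div m")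
      case True
      have "norm (E (N div m) - E Z) \<le> norm (E (N div m)) + norm (E Z)" by (rule norm_triangle_ineq4)
      thus ?thesis using E'[OF True order_refl] E'[OF order_refl True] unfolding if_P[OF True] by linarith
    qed (use assms in simp)
    hence "norm (exp_mult a m) * norm (if Z \<le> N div m then E (N div m) - E Z else 0)
        \<le> norm (exp_mult a m) * (2 * (C * (real N / real m) / ln (real Z) powr A))"
      by (intro mult_left_mono) auto
    thus "norm (exp_mult a m * (if Z \<le> N div m then E (N div m) - E Z else 0))
        \<le> ?X * (norm (exp_mult a m) / real m)"
      by (simp add: norm_mult mult_ac)
  qed
  also have "\<dots> = ?X * (\<Sum>m=1..N. norm (exp_mult a m) / real m)" by (simp add: sum_distrib_left)
  also have "\<dots> \<le> ?X * (exp (1 + 2 * k) * (1 + ln (real N)) powr k)"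
    using assms by (intro mult_left_mono sum_norm_exp_mult_over_le) auto
  finally show ?thesis .
qed

text \<open>The weights are at most 1/n and cancel the factor n in the bounds for
  \<open>S n\<close>, so no extra logarithm appears. Below sqrt N the power (ln n)^b may far exceed
  (ln N)^b, so the trivial bound is used there; there are at most sqrt N such terms.\<close>

lemma norm_abel_part_le:
  fixes S :: "nat \<Rightarrow> complex"
  assumes "M \<ge> 0" "K \<ge> 0" "k \<ge> 0" and N: "N \<ge> 2"
    and triv: "\<And>n. n \<ge> 1 \<Longrightarrow> norm (S n) \<le> K * real n * (1 + ln (real n)) powr k"
    and IH: "\<And>n. 2 \<le> n \<Longrightarrow> n < N \<Longrightarrow> norm (S n) \<le> M * real n * ln (real n) powr b"
  shows "norm (\<Sum>n\<in>{1..<N}. S n * of_real (ln (real (Suc n)) - ln (real n)))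
       \<le> M * 2 powr \<bar>b\<bar> * real N * ln (real N) powr b
         + K * sqrt (real N) * (1 + ln (real N)) powr k"
proof -
  let ?Y = "M * (2 powr \<bar>b\<bar> * ln (real N) powr b)" and ?X = "K * (1 + ln (real N)) powr k"
  let ?I = "{n\<in>{1..<N}. real n < sqrt (real N)}"
  have "norm (\<Sum>n\<in>{1..<N}. S n * of_real (ln (real (Suc n)) - ln (real n)))
      \<le> (\<Sum>n\<in>{1..<N}. ?Y + (if real n < sqrt (real N) then ?X else 0))"
  proof (intro sum_norm_le)
    fix n assume n: "n \<in> {1..<N}"
    have "ln (real (Suc n)) - ln (real n) = ln (real (Suc n) / real n)" using n by (subst ln_div) auto
    also have "real (Suc n) / real n = 1 + 1 / real n" using n by (simp add: field_simps)
    also have "ln (1 + 1 / real n) \<le> 1 / real n" by (intro ln_add_one_self_le_self) auto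
    finally have l: "ln (real (Suc n)) - ln (real n) \<le> 1 / real n" .
    have l0: "ln (real (Suc n)) - ln (real n) \<ge> 0" using n by simp
    have "norm (S n * of_real (ln (real (Suc n)) - ln (real n)))
        = norm (S n) * (ln (real (Suc n)) - ln (real n))"
      using l0 by (simp only: norm_mult norm_of_real abs_of_nonneg)
    also have "\<dots> \<le> norm (S n) * (1 / real n)" using l by (intro mult_left_mono) auto
    also have "\<dots> \<le> ?Y + (if real n < sqrt (real N) then ?X else 0)"
    proof (cases "real n < sqrt (real N)")
      case True
      have "norm (S n) \<le> K * real n * (1 + ln (real n)) powr k" using triv n by simp
      also have "\<dots> \<le> K * real n * (1 + ln (real N)) powr k"
        using n assms by (intro mult_left_mono powr_mono2) (auto simp: add_nonneg_nonneg)
      finally have "norm (S n) * (1 / real n) \<le> ?X" using n by (simp add: field_simps)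
      moreover have "?Y \<ge> 0" using assms by simp
      ultimately show ?thesis using True by simp
    next
      case False
      have "sqrt (real N) > 1" using N by simp
      hence "n \<ge> 2" using False by (cases "n = 0 \<or> n = 1") auto
      hence "norm (S n) \<le> M * real n * ln (real n) powr b" using IH n by simp
      also have "\<dots> \<le> M * real n * (2 powr \<bar>b\<bar> * ln (real N) powr b)"
        using n N False assms by (intro mult_left_mono ln_powr_le_of_sqrt_le) auto
      finally have "norm (S n) * (1 / real n) \<le> ?Y" using n by (simp add: field_simps)
      thus ?thesis using False by simp
    qed
    finally show "norm (S n * of_real (ln (real (Suc n)) - ln (real n)))
        \<le> ?Y + (if real n < sqrt (real N) then ?X else 0)" .
  qed
  also have "\<dots> = real (N - 1) * ?Y + real (card ?I) * ?X"
    by (simp add: sum.distrib sum.inter_filter[symmetric])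
  also have "\<dots> \<le> real N * ?Y + sqrt (real N) * ?X"
  proof (intro add_mono mult_right_mono)
    have "?I \<subseteq> {1..nat \<lfloor>sqrt (real N)\<rfloor>}" by (auto simp: le_nat_iff le_floor_iff)
    hence "card ?I \<le> card {1..nat \<lfloor>sqrt (real N)\<rfloor>}" by (intro card_mono) auto
    hence "real (card ?I) \<le> real (nat \<lfloor>sqrt (real N)\<rfloor>)"
      by (simp only: card_atLeastAtMost diff_Suc_1 of_nat_le_iff)
    also have "\<dots> \<le> sqrt (real N)" by (intro of_nat_floor) simp
    finally show "real (card ?I) \<le> sqrt (real N)" .
  qed (use assms in auto)
  finally show ?thesis by (simp add: mult_ac)
qed

text \<open>The constant comes from raising ln x <= x^(d/a) / (d/a) to the power a.\<close>

lemma ln_powr_le_powr: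
  fixes x a d :: real
  assumes "x \<ge> 1" "a > 0" "d > 0"
  shows "ln x powr a \<le> (a / d) powr a * x powr d"
proof -
  have "ln x powr a \<le> (x powr (d / a) / (d / a)) powr a"
    using assms by (intro powr_mono2 ln_powr_bound) auto
  also have "\<dots> = (a / d * x powr (d / a)) powr a" by (simp add: mult.commute)
  also have "\<dots> = (a / d) powr a * x powr d"
    using assms by (simp only: powr_mult powr_powr) simp
  finally show ?thesis .
qed

lemma one_plus_powr_le:
  fixes l k :: real
  assumes "l \<ge> 1" "k \<ge> 0"
  shows "(1 + l) powr k \<le> 2 powr k * l powr k"
proof -
  have "(1 + l) powr k \<le> (2 * l) powr k" using assms by (intro powr_mono2) auto
  thus ?thesis by (simp add: powr_mult)
qed

text \<open>The order of quantifiers is the point: \<open>C1\<close> and \<open>N0\<close> are fixed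
  before \<open>a\<close>, \<open>M\<close> and \<open>N\<close>. The map sending M to C1 + M/2 is
  then a contraction, so any M >= 2 C1 is preserved.\<close>

lemma exp_mult_induction_step:
  fixes k A C :: real
  assumes k: "k > 0" and A: "A > 0" and C: "C \<ge> 0"
  shows "\<exists>C1\<ge>0. \<exists>N0. \<forall>a M N.
      (\<forall>p. prime p \<longrightarrow> norm (a p) \<le> k) \<longrightarrow>
      (\<forall>n\<ge>2. norm (\<Sum>p\<in>{p. prime p} \<inter> {1..n}. a p * of_real (ln (real p)))
           \<le> C * real n / ln (real n) powr A) \<longrightarrow>
      M \<ge> 0 \<longrightarrow> N \<ge> N0 \<longrightarrow>
      (\<forall>n. 2 \<le> n \<longrightarrow> n < N \<longrightarrow>
         norm (\<Sum>m=1..n. exp_mult a m) \<le> M * real n * ln (real n) powr (k - 1 - A)) \<longrightarrow>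
      norm (\<Sum>m=1..N. exp_mult a m) \<le> (C1 + M / 2) * real N * ln (real N) powr (k - 1 - A)"
proof -
  define b where "b = k - 1 - A"
  define B where "B = 2 powr \<bar>b\<bar>"
  \<comment> \<open>The value 1/4 keeps \<open>N div p\<close> above sqrt N for all p <= Z. The
    other one makes 4 k B \<epsilon> at most 1/4, so the small primes contribute at most a quarter
    of M ln N to leading order.\<close>
  define \<epsilon> where "\<epsilon> = min (1 / 4) (1 / (16 * k * B))"
  define K where "K = exp (1 + 2 * k)"
  \<comment> \<open>The first summand comes from the large primes, where ln Z >= (\<epsilon>/2) ln
    N. The second comes from the arguments below sqrt N, where (ln N)^A <= (2A)^A sqrt N.\<close>
  define C1 where "C1 = 2 powr k * K * (2 * C * (2 / \<epsilon>) powr A + (2 * A) powr A)"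
  \<comment> \<open>The bound 16 serves \<open>sqrt_le_div\<close>, the power of 2 ensures
    N^\<epsilon> >= 2, and the exponential makes the terms in M without a logarithm, B (2k + 1) in
    total, at most (ln N) / 4.\<close>
  define N0 where "N0 = max 16 (nat \<lceil>max (2 powr (1 / \<epsilon>)) (exp (4 * B * (2 * k + 1)))\<rceil>)"
  have B: "B \<ge> 1" unfolding B_def by (intro ge_one_powr_ge_zero) auto
  have eps: "\<epsilon> > 0" "\<epsilon> \<le> 1 / 4" "\<epsilon> \<le> 1 / (16 * k * B)" using k B by (auto simp: \<epsilon>_def)
  have epsk: "4 * k * B * \<epsilon> \<le> 1 / 4"
    using eps(3) k B by (simp add: field_simps)
  have K: "K > 0" by (simp add: K_def)
  have C1: "C1 \<ge> 0" using K C by (simp add: C1_def)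
  have main: "norm (\<Sum>m=1..N. exp_mult a m) \<le> (C1 + M / 2) * real N * ln (real N) powr b"
    if ak: "\<And>p. prime p \<Longrightarrow> norm (a p) \<le> k"
      and E: "\<And>n. n \<ge> 2 \<Longrightarrow> norm (\<Sum>p\<in>{p. prime p} \<inter> {1..n}. a p * of_real (ln (real p)))
                \<le> C * real n / ln (real n) powr A"
      and M: "M \<ge> 0" and N: "N \<ge> N0"
      and IH: "\<And>n. 2 \<le> n \<Longrightarrow> n < N \<Longrightarrow>
         norm (\<Sum>m=1..n. exp_mult a m) \<le> M * real n * ln (real n) powr b"
    for a M N
  proof -
    define S where "S = (\<lambda>n. \<Sum>m=1..n. exp_mult a m)"
    define E' where "E' = (\<lambda>n::nat. \<Sum>p\<in>{p. prime p} \<inter> {1..n}. a p * of_real (ln (real p)))"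
    define l where "l = ln (real N)"
    define Z where "Z = nat \<lfloor>real N powr \<epsilon>\<rfloor>"
    have N16: "N \<ge> 16" and N1: "2 powr (1 / \<epsilon>) \<le> real N" and N2: "exp (4 * B * (2 * k + 1)) \<le> real N"
      using N by (auto simp: N0_def nat_le_iff ceiling_le_iff)
    have l: "4 * B * (2 * k + 1) \<le> l"
      using N2 N16 by (simp add: l_def ln_ge_iff)
    have "1 \<le> 4 * B * (2 * k + 1)" using B k mult_mono[of 1 "4 * B" 1 "2 * k + 1"] by simp
    hence l1: "l \<ge> 1" using l by simp
    have "(2 powr (1 / \<epsilon>)) powr \<epsilon> \<le> real N powr \<epsilon>" using N1 eps by (intro powr_mono2) auto
    hence Ne: "real N powr \<epsilon> \<ge> 2" using eps by (simp add: powr_powr)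
    have Zge: "sqrt (real N powr \<epsilon>) \<le> real Z" unfolding Z_def by (rule sqrt_le_floor[OF Ne])
    have Zle: "real Z \<le> real N powr \<epsilon>" unfolding Z_def by (intro of_nat_floor) simp
    have Z2: "Z \<ge> 2" using Ne unfolding Z_def by (simp add: le_nat_iff le_floor_iff)
    have Zq: "real Z \<le> real N powr (1 / 4)"
      using eps N16 by (intro order_trans[OF Zle] powr_mono) auto
    have "real N powr (1 / 4) \<le> real N powr 1" using N16 by (intro powr_mono) auto
    hence ZN: "Z \<le> N" using Zq N16 by simp
    have lnZ: "\<epsilon> / 2 * l \<le> ln (real Z)"
    proof -
      have "ln (sqrt (real N powr \<epsilon>)) \<le> ln (real Z)"
        using Zge Z2 Ne N16 by (subst ln_le_cancel_iff) auto
      thus ?thesis using N16 by (simp add: ln_sqrt ln_powr l_def)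
    qed
    have lnZ': "ln (real Z) \<le> \<epsilon> * l"
    proof -
      have "ln (real Z) \<le> ln (real N powr \<epsilon>)" using Zle Z2 N16 by (subst ln_le_cancel_iff) auto
      thus ?thesis using N16 by (simp add: ln_powr l_def)
    qed
    \<comment> \<open>The trivial exponent k exceeds b by A + 1. One logarithm is divided out at the
      end; \<open>l powr A\<close> is cancelled by the saving over large primes or absorbed by sqrt
      N.\<close>
    have lk: "l powr k = l * l powr b * l powr A"
      using l1 by (simp add: b_def powr_diff)
    have X: "(1 + l) powr k \<le> 2 powr k * (l * l powr b * l powr A)"
      using one_plus_powr_le[of l k] l1 k lk by simp
    let ?W = "real N * l powr b"
    have "S N * of_real l = (\<Sum>n=1..N. exp_mult a n * of_real (ln (real n)))
        + (\<Sum>n=1..N. exp_mult a n * of_real (ln (real N) - ln (real n)))"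
      unfolding S_def l_def sum_distrib_right sum.distrib[symmetric]
      by (intro sum.cong refl) (simp add: algebra_simps)
    also have "(\<Sum>n=1..N. exp_mult a n * of_real (ln (real n)))
        = (\<Sum>p\<in>{p. prime p} \<inter> {1..Z}. a p * of_real (ln (real p)) * S (N div p))
        + (\<Sum>m=1..N. exp_mult a m * (if Z \<le> N div m then E' (N div m) - E' Z else 0))"
      unfolding S_def E'_def sum_exp_mult_ln by (rule hyperbola_split[OF ZN])
    also have "(\<Sum>n=1..N. exp_mult a n * of_real (ln (real N) - ln (real n)))
        = (\<Sum>n\<in>{1..<N}. S n * of_real (ln (real (Suc n)) - ln (real n)))"
      unfolding S_def by (rule sum_mult_ln_diff)
    finally have eq: "S N * of_real l
        = (\<Sum>p\<in>{p. prime p} \<inter> {1..Z}. a p * of_real (ln (real p)) * S (N div p))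
        + (\<Sum>m=1..N. exp_mult a m * (if Z \<le> N div m then E' (N div m) - E' Z else 0))
        + (\<Sum>n\<in>{1..<N}. S n * of_real (ln (real (Suc n)) - ln (real n)))"
      (is "_ = ?T1 + ?T2 + ?T3") .
    have "norm ?T1 \<le> k * M * B * real N * l powr b * (2 + 4 * ln (real Z))"
      unfolding B_def l_def
      using k M N16 Z2 Zq ak IH by (intro norm_prime_part_le) (auto simp: S_def)
    also have "\<dots> \<le> k * M * B * real N * l powr b * (2 + 4 * (\<epsilon> * l))"
      using lnZ' k M B by (intro mult_left_mono) auto
    also have "\<dots> = ?W * (2 * k * M * B + 4 * k * B * \<epsilon> * (M * l))"
      by (simp add: algebra_simps)
    also have "\<dots> \<le> ?W * (2 * k * M * B + 1 / 4 * (M * l))"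
      using epsk M l1 k B by (intro mult_left_mono add_mono mult_right_mono) auto
    finally have T1: "norm ?T1 \<le> ?W * (2 * k * M * B + 1 / 4 * (M * l))" .
    have "norm ?T2 \<le> 2 * C * real N / ln (real Z) powr A * (K * (1 + l) powr k)"
      unfolding K_def l_def
      using k C A N16 Z2 ak E by (intro norm_cofactor_part_le) (auto simp: E'_def)
    also have "\<dots> \<le> 2 * C * real N / (\<epsilon> / 2 * l) powr A * (K * (2 powr k * (l * l powr b * l powr A)))"
      using lnZ X K C A l1 eps by (intro mult_mono frac_le powr_mono2 mult_left_mono) auto
    also have "\<dots> = ?W * (2 powr k * K * (2 * C * (2 / \<epsilon>) powr A) * l)"
    proof -
      have 1: "(\<epsilon> / 2 * l) powr A = (\<epsilon> / 2) powr A * l powr A" by (rule powr_mult)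
      have 2: "(2 / \<epsilon>) powr A = 1 / (\<epsilon> / 2) powr A" by (simp add: powr_divide)
      have 3: "x / (u * y) * (K * (v * (l * w * y))) = z * w * (v * K * (2 * C * (1 / u)) * l)"
        if "x = 2 * C * z" "u > 0" "y > 0" for x u y v w z :: real
        using that by (simp add: field_simps)
      show ?thesis unfolding 1 2 using l1 eps by (intro 3) auto
    qed
    finally have T2: "norm ?T2 \<le> ?W * (2 powr k * K * (2 * C * (2 / \<epsilon>) powr A) * l)" .
    have "norm ?T3 \<le> M * B * real N * l powr b + K * sqrt (real N) * (1 + l) powr k"
      unfolding B_def l_def
    proof (rule norm_abel_part_le)
      show "norm (S n) \<le> K * real n * (1 + ln (real n)) powr k" if "n \<ge> 1" for n
        unfolding S_def K_def using k ak that by (intro norm_sum_exp_mult_le) auto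
    qed (use k M N16 K IH in \<open>auto simp: S_def\<close>)
    also have "K * sqrt (real N) * (1 + l) powr k
        \<le> K * sqrt (real N) * (2 powr k * (l * l powr b * ((2 * A) powr A * sqrt (real N))))"
    proof (intro mult_left_mono order_trans[OF X])
      have "l powr A \<le> (A / (1 / 2)) powr A * real N powr (1 / 2)"
        unfolding l_def using A N16 by (intro ln_powr_le_powr) auto
      thus "l powr A \<le> (2 * A) powr A * sqrt (real N)"
        using N16 by (simp add: powr_half_sqrt mult.commute)
    qed (use K l1 in auto)
    also have "\<dots> = ?W * (2 powr k * K * (2 * A) powr A * l)"
    proof -
      have "K * s * (v * (l * w * (u * s))) = s * s * w * (v * K * u * l)" for s v w u :: real
        by (simp add: mult_ac)
      from this[of "sqrt (real N)"] show ?thesis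
        by (simp only: real_sqrt_mult_self abs_of_nat)
    qed
    also have "M * B * real N * l powr b = ?W * (M * B)" by (simp add: mult_ac)
    finally have T3: "norm ?T3 \<le> ?W * (M * B) + ?W * (2 powr k * K * (2 * A) powr A * l)" by simp
    have "norm (S N) * l = norm (S N * of_real l)" using l1 by (simp add: norm_mult)
    also have "\<dots> \<le> norm ?T1 + norm ?T2 + norm ?T3"
      unfolding eq by (intro norm_triangle_mono order_refl)
    also have "\<dots> \<le> ?W * (2 * k * M * B + 1 / 4 * (M * l))
        + ?W * (2 powr k * K * (2 * C * (2 / \<epsilon>) powr A) * l)
        + (?W * (M * B) + ?W * (2 powr k * K * (2 * A) powr A * l))"
      by (intro add_mono T1 T2 T3)
    also have "\<dots> = ?W * (M * (B * (2 * k + 1)) + 1 / 4 * (M * l) + C1 * l)"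
      by (simp add: C1_def algebra_simps)
    also have "\<dots> \<le> ?W * (M * (l / 4) + 1 / 4 * (M * l) + C1 * l)"
      using l M by (intro mult_left_mono add_mono order_refl) auto
    also have "\<dots> = (?W * (C1 + M / 2)) * l" by (simp add: algebra_simps)
    finally have "norm (S N) \<le> ?W * (C1 + M / 2)"
      using l1 by (subst (asm) mult_le_cancel_right) auto
    thus ?thesis by (simp add: S_def l_def mult_ac)
  qed
  show ?thesis unfolding b_def[symmetric]
    by (rule exI[of _ C1], rule conjI[OF C1], rule exI[of _ N0]) (intro allI impI main; blast)
qed

lemma sum_exp_mult_bound:
  fixes k A C :: real
  assumes k: "k > 0" and A: "A > 0" and C: "C \<ge> 0"
  shows "\<exists>M\<ge>0. \<forall>a.
      (\<forall>p. prime p \<longrightarrow> norm (a p) \<le> k) \<longrightarrow>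
      (\<forall>n\<ge>2. norm (\<Sum>p\<in>{p. prime p} \<inter> {1..n}. a p * of_real (ln (real p)))
           \<le> C * real n / ln (real n) powr A) \<longrightarrow>
      (\<forall>N\<ge>2. norm (\<Sum>m=1..N. exp_mult a m) \<le> M * real N * ln (real N) powr (k - 1 - A))"
proof -
  define b where "b = k - 1 - A"
  obtain C1 N0 where C1: "C1 \<ge> 0" and step: "\<And>a M N.
      (\<forall>p. prime p \<longrightarrow> norm (a p) \<le> k) \<Longrightarrow>
      (\<forall>n\<ge>2. norm (\<Sum>p\<in>{p. prime p} \<inter> {1..n}. a p * of_real (ln (real p)))
           \<le> C * real n / ln (real n) powr A) \<Longrightarrow>
      M \<ge> 0 \<Longrightarrow> N \<ge> N0 \<Longrightarrow>
      (\<forall>n. 2 \<le> n \<longrightarrow> n < N \<longrightarrow>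
         norm (\<Sum>m=1..n. exp_mult a m) \<le> M * real n * ln (real n) powr b) \<Longrightarrow>
      norm (\<Sum>m=1..N. exp_mult a m) \<le> (C1 + M / 2) * real N * ln (real N) powr b"
    using exp_mult_induction_step[OF assms] unfolding b_def by blast
  define c where "c = (\<lambda>n::nat. exp (1 + 2 * k) * (1 + ln (real n)) powr k / ln (real n) powr b)"
  \<comment> \<open>The part 2 C1 gives C1 + M/2 <= M for N >= N0. The finite sum of ratios of the
    trivial bound to the target covers each N below N0.\<close>
  define M where "M = 2 * C1 + (\<Sum>n=2..N0. c n)"
  have c0: "c n \<ge> 0" for n by (simp add: c_def)
  have M: "M \<ge> 0" "C1 \<le> M / 2" using C1 c0 by (auto simp: M_def intro!: add_nonneg_nonneg sum_nonneg)
  have "norm (\<Sum>m=1..N. exp_mult a m) \<le> M * real N * ln (real N) powr b"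
    if ak: "\<forall>p. prime p \<longrightarrow> norm (a p) \<le> k"
      and E: "\<forall>n\<ge>2. norm (\<Sum>p\<in>{p. prime p} \<inter> {1..n}. a p * of_real (ln (real p)))
           \<le> C * real n / ln (real n) powr A" and "N \<ge> 2" for a N
    using \<open>N \<ge> 2\<close>
  proof (induction N rule: less_induct)
    case (less N)
    show ?case
    proof (cases "N \<ge> N0")
      case True
      have "norm (\<Sum>m=1..N. exp_mult a m) \<le> (C1 + M / 2) * real N * ln (real N) powr b"
        using less.IH by (intro step ak E M True) auto
      also have "\<dots> \<le> M * real N * ln (real N) powr b"
        using M by (intro mult_right_mono) auto
      finally show ?thesis .
    next
      case False
      have "c N \<le> (\<Sum>n=2..N0. c n)"
        using less.prems False c0 by (intro member_le_sum) auto
      hence "c N \<le> M" using C1 by (simp add: M_def)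
      have "norm (\<Sum>m=1..N. exp_mult a m) \<le> exp (1 + 2 * k) * real N * (1 + ln (real N)) powr k"
        using k ak less.prems by (intro norm_sum_exp_mult_le) auto
      also have "\<dots> = c N * (real N * ln (real N) powr b)"
        using less.prems by (simp add: c_def)
      also have "\<dots> \<le> M * (real N * ln (real N) powr b)"
        using \<open>c N \<le> M\<close> by (intro mult_right_mono) auto
      finally show ?thesis by (simp add: mult_ac)
    qed
  qed
  thus ?thesis unfolding b_def[symmetric] using M(1) by blast
qed

section \<open>Passage to general multiplicative functions\<close>

lemma pochhammer_over_fact_eq:
  fixes k :: real
  shows "(k + real v - 1) gchoose v = pochhammer k v / fact v"
  by (simp add: gbinomial_pochhammer')

lemma tau_prime_power:
  assumes "prime p"
  shows "tau k (p ^ v) = pochhammer k v / fact v"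
proof (cases "v = 0")
  case False
  hence "prime_factors (p ^ v) = {p}"
    using assms by (simp add: prime_factorization_prime_power)
  moreover have "multiplicity p (p ^ v) = v"
    using assms by (simp add: multiplicity_same_power)
  ultimately show ?thesis by (simp add: tau_def pochhammer_over_fact_eq)
qed (simp add: tau_def)

lemma tau_prime: "prime p \<Longrightarrow> tau k p = k"
  using tau_prime_power[of p k 1] by simp

text \<open>These are the terms of the binomial series of (1 - r)^(-k), the Bell series of
  \<open>tau k\<close>; the signs of the binomial with upper entry -k cancel those of
  (-r)^v.\<close>

lemma summable_pochhammer_over_fact:
  fixes k r :: real
  assumes "0 < r" "r < 1"
  shows "summable (\<lambda>v. pochhammer k v / fact v * r ^ v)"
proof -
  have "summable (\<lambda>v. ((- k) gchoose v) * (- r) ^ v)"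
    using gen_binomial_real[of "- r" "- k"] assms by (auto simp: sums_iff)
  moreover have "((- k) gchoose v) * (- r) ^ v = pochhammer k v / fact v * r ^ v" for v
    by (simp add: gbinomial_minus pochhammer_over_fact_eq power_mult_distrib[symmetric])
  ultimately show ?thesis by simp
qed

text \<open>
  With \<open>F\<close> the Bell series of \<open>f\<close> at \<open>p\<close>, the quotient \<open>F / exp (f(p) X)\<close> has no linear term; its
  coefficients are the values at powers of \<open>p\<close> of the function \<open>h\<close> with \<open>f = h * g\<close>.
\<close>

definition corr_coeff :: "(nat \<Rightarrow> complex) \<Rightarrow> nat \<Rightarrow> nat \<Rightarrow> complex" where
  "corr_coeff f p v = fps_nth (Abs_fps (\<lambda>i. f (p ^ i)) * fps_exp (- f p)) v"

text \<open>The coefficients of (1 - X)^(-k) exp (k X), the majorant of the quotient series. They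
  are the same for all primes and all \<open>f\<close>.\<close>

definition corr_bound :: "real \<Rightarrow> nat \<Rightarrow> real" where
  "corr_bound k v = (\<Sum>i\<le>v. pochhammer k i / fact i * (k ^ (v - i) / fact (v - i)))"

lemma corr_coeff_0 [simp]: "f (Suc 0) = 1 \<Longrightarrow> corr_coeff f p 0 = 1"
  by (simp add: corr_coeff_def)

lemma corr_coeff_1 [simp]: "f (Suc 0) = 1 \<Longrightarrow> corr_coeff f p (Suc 0) = 0"
  by (simp add: corr_coeff_def fps_mult_nth)

lemma corr_coeff_convolution:
  "(\<Sum>i\<le>v. corr_coeff f p i * (f p ^ (v - i) / fact (v - i))) = f (p ^ v)"
proof -
  let ?F = "Abs_fps (\<lambda>i. f (p ^ i))"
  have "fps_exp (- f p) * fps_exp (f p) = 1"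
    using fps_exp_add_mult[of "- f p" "f p"] by simp
  hence "fps_nth (?F * fps_exp (- f p) * fps_exp (f p)) v = f (p ^ v)"
    by (simp only: mult.assoc mult_1_right fps_nth_Abs_fps)
  thus ?thesis by (simp add: fps_mult_nth[of "?F * fps_exp (- f p)"] corr_coeff_def atMost_atLeast0)
qed

lemma norm_corr_coeff_le:
  assumes f: "\<forall>n\<ge>1. norm (f n) \<le> tau k n" and p: "prime p" and k: "k > 0"
  shows "norm (corr_coeff f p v) \<le> corr_bound k v"
proof -
  have "norm (corr_coeff f p v) \<le> (\<Sum>i=0..v. norm (f (p ^ i) * ((- f p) ^ (v - i) / fact (v - i))))"
    by (simp add: corr_coeff_def fps_mult_nth norm_sum)
  also have "\<dots> \<le> (\<Sum>i=0..v. pochhammer k i / fact i * (k ^ (v - i) / fact (v - i)))"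
  proof (intro sum_mono)
    fix i
    have "norm (f (p ^ i)) \<le> pochhammer k i / fact i"
      using f p tau_prime_power[OF p, of k i] prime_gt_0_nat[OF p] by (metis One_nat_def Suc_leI zero_less_power)
    moreover have "norm (f p) \<le> k"
      using f p tau_prime[OF p, of k] prime_ge_1_nat[OF p] by metis
    ultimately show "norm (f (p ^ i) * ((- f p) ^ (v - i) / fact (v - i)))
        \<le> pochhammer k i / fact i * (k ^ (v - i) / fact (v - i))"
      unfolding norm_mult norm_divide norm_power norm_minus_cancel norm_fact using k
      by (intro mult_mono divide_right_mono power_mono) (auto intro!: divide_nonneg_nonneg pochhammer_nonneg)
  qed
  finally show ?thesis by (simp add: corr_bound_def atMost_atLeast0)
qed

lemma corr_bound_nonneg: "k > 0 \<Longrightarrow> corr_bound k v \<ge> 0"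
  unfolding corr_bound_def by (intro sum_nonneg mult_nonneg_nonneg divide_nonneg_nonneg pochhammer_nonneg) auto

lemma summable_corr_bound:
  assumes k: "k > 0" and r: "0 < r" "r < 1"
  shows "summable (\<lambda>v. corr_bound k v * r ^ v)"
proof -
  have "summable (\<lambda>v. \<Sum>i\<le>v. (pochhammer k i / fact i * r ^ i) * ((k * r) ^ (v - i) / fact (v - i)))"
  proof (rule summable_Cauchy_product)
    show "summable (\<lambda>v. norm (pochhammer k v / fact v * r ^ v))"
      using summable_pochhammer_over_fact[OF r, of k] k r
      by (simp add: abs_mult abs_divide pochhammer_nonneg)
    show "summable (\<lambda>v. norm ((k * r) ^ v / fact v))"
      using summable_exp[of "k * r"] k r by (simp add: abs_mult divide_inverse mult.commute)
  qed
  moreover have "(\<Sum>i\<le>v. (pochhammer k i / fact i * r ^ i) * ((k * r) ^ (v - i) / fact (v - i)))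
      = corr_bound k v * r ^ v" for v
  proof -
    have "(pochhammer k i / fact i * r ^ i) * ((k * r) ^ (v - i) / fact (v - i))
        = pochhammer k i / fact i * (k ^ (v - i) / fact (v - i)) * r ^ v" if "i \<le> v" for i
    proof -
      have "r ^ v = r ^ i * r ^ (v - i)" using that by (simp add: power_add[symmetric])
      thus ?thesis by (simp add: power_mult_distrib)
    qed
    thus ?thesis unfolding corr_bound_def sum_distrib_right by (intro sum.cong) auto
  qed
  ultimately show ?thesis by simp
qed

text \<open>The majorant series converges inside the unit disc, so its value at r = 2^(-3/4), the
  largest p^(-3/4), bounds all local factors at once. The missing linear term then yields a
  convergent factor p^(-3/2).\<close>

lemma sum_corr_coeff_bounded:
  assumes k: "k > 0"
  shows "\<exists>H\<ge>0. \<forall>f. f 1 = 1 \<longrightarrow> (\<forall>n\<ge>1. norm (f n) \<le> tau k n) \<longrightarrow>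
     (\<forall>N. (\<Sum>d=1..N. norm (mult_ext (corr_coeff f) d) * real d powr - (3 / 4)) \<le> H)"
proof -
  define r :: real where "r = 2 powr - (3 / 4)"
  have r: "0 < r" "r < 1" using powr_less_mono[of "- (3 / 4)" 0 "2::real"] by (auto simp: r_def)
  define B where "B = 2 powr (3 / 2) * (\<Sum>v. corr_bound k v * r ^ v)"
  have B0: "B \<ge> 0"
    unfolding B_def using k r
    by (intro mult_nonneg_nonneg suminf_nonneg summable_corr_bound) (auto simp: corr_bound_nonneg)
  have "(\<Sum>d=1..N. norm (mult_ext (corr_coeff f) d) * real d powr - (3 / 4)) \<le> exp (B * 3)"
    if f1: "f 1 = 1" and f: "\<forall>n\<ge>1. norm (f n) \<le> tau k n" for f N
  proof -
    let ?u = "\<lambda>p v. norm (corr_coeff f p v) * (real p powr - (3 / 4)) ^ v"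
    have "(\<Sum>d=1..N. norm (mult_ext (corr_coeff f) d) * real d powr - (3 / 4)) = (\<Sum>d=1..N. mult_ext ?u d)"
      by (intro sum.cong refl, subst mult_ext_mult_powr) (auto simp: norm_mult_ext)
    also have "\<dots> \<le> (\<Prod>p | prime p \<and> p \<le> N. \<Sum>v\<le>N. ?u p v)"
      using f1 by (intro sum_mult_ext_le_prod) auto
    also have "\<dots> \<le> (\<Prod>p | prime p \<and> p \<le> N. exp (B * real p powr - (3 / 2)))"
    proof (intro prod_mono conjI)
      fix p assume "p \<in> {p. prime p \<and> p \<le> N}"
      hence p: "prime p" by simp
      have p2: "real p \<ge> 2" using prime_ge_2_nat[OF p] by simp
      let ?c = "2 powr (3 / 2) * real p powr - (3 / 2)"
      have "?u p v \<le> (if v = 0 then 1 else 0) + corr_bound k v * r ^ v * ?c" for v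
      proof -
        have nn: "corr_bound k v * r ^ v * ?c \<ge> 0"
          using corr_bound_nonneg[OF k] r by (intro mult_nonneg_nonneg) auto
        \<comment> \<open>The coefficient at v = 1 vanishes. For v >= 2 the decay (p/2)^(-3v/4) is
          at most (p/2)^(-3/2), which explains the factor 2^(3/2) in \<open>B\<close>, while r^v is
          kept for summability.\<close>
        consider "v = 0" | "v = 1" | "v \<ge> 2" by linarith
        thus ?thesis
        proof cases
          case 3
          have "(real p powr - (3 / 4)) ^ v = (r * (real p / 2) powr - (3 / 4)) ^ v"
            unfolding r_def by (subst powr_mult[symmetric]) simp
          also have "\<dots> = r ^ v * (real p / 2) powr (- (3 / 4) * real v)"
            using p2 by (simp add: power_mult_distrib powr_realpow[symmetric] powr_powr)
          also have "\<dots> \<le> r ^ v * (real p / 2) powr - (3 / 2)"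
            using p2 3 r by (intro mult_left_mono powr_mono) auto
          also have "(real p / 2) powr - (3 / 2) = ?c"
            by (subst powr_divide) (simp add: powr_minus field_simps)
          finally have "?u p v \<le> corr_bound k v * (r ^ v * ?c)"
            using norm_corr_coeff_le[OF f p k, of v] corr_bound_nonneg[OF k] by (intro mult_mono) auto
          thus ?thesis using 3 by (simp add: mult_ac)
        qed (use nn f1 in auto)
      qed
      hence "(\<Sum>v\<le>N. ?u p v) \<le> (\<Sum>v\<le>N. (if v = 0 then 1 else 0) + corr_bound k v * r ^ v * ?c)"
        by (intro sum_mono)
      also have "\<dots> = 1 + (\<Sum>v\<le>N. corr_bound k v * r ^ v) * ?c"
        by (simp add: sum.distrib sum_distrib_right)
      also have "(\<Sum>v\<le>N. corr_bound k v * r ^ v) \<le> (\<Sum>v. corr_bound k v * r ^ v)"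
        using corr_bound_nonneg[OF k] r by (intro sum_le_suminf summable_corr_bound k) auto
      hence "1 + (\<Sum>v\<le>N. corr_bound k v * r ^ v) * ?c \<le> 1 + (\<Sum>v. corr_bound k v * r ^ v) * ?c"
        by (intro add_left_mono mult_right_mono) auto
      also have "\<dots> = 1 + B * real p powr - (3 / 2)" by (simp add: B_def)
      also have "\<dots> \<le> exp (B * real p powr - (3 / 2))" by (rule exp_ge_add_one_self)
      finally show "(\<Sum>v\<le>N. ?u p v) \<le> exp (B * real p powr - (3 / 2))" .
    qed (auto intro!: sum_nonneg)
    also have "\<dots> = exp (B * (\<Sum>p | prime p \<and> p \<le> N. real p powr - (3 / 2)))"
      by (simp add: exp_sum sum_distrib_left)
    also have "\<dots> \<le> exp (B * (\<Sum>n=1..N. real n powr - (3 / 2)))"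
      using B0 by (intro iffD2[OF exp_le_cancel_iff] mult_left_mono sum_mono2) (auto simp: prime_ge_Suc_0_nat)
    also have "\<dots> \<le> exp (B * 3)"
      using B0 sum_powr_le[of "3 / 2" N] by (intro iffD2[OF exp_le_cancel_iff] mult_left_mono) auto
    finally show ?thesis .
  qed
  thus ?thesis by (intro exI[of _ "exp (B * 3)"]) auto
qed

section \<open>Convolving back to the given function\<close>

lemma sum_multiplicative_eq:
  assumes f: "multiplicative f"
  shows "(\<Sum>n=1..N. f n) = (\<Sum>d=1..N. mult_ext (corr_coeff f) d * (\<Sum>m=1..N div d. exp_mult f m))"
proof -
  have f1: "f (Suc 0) = 1" using f by (simp add: multiplicative_def)
  have "(\<Sum>n=1..N. f n)
      = (\<Sum>n=1..N. \<Sum>d | d \<in> UNIV \<and> d dvd n. mult_ext (corr_coeff f) d * exp_mult f (n div d))"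
  proof (intro sum.cong refl)
    fix n assume "n \<in> {1..N}"
    hence n: "n > 0" by simp
    have "(\<Sum>d | d dvd n. mult_ext (corr_coeff f) d * exp_mult f (n div d))
        = mult_ext (\<lambda>p v. \<Sum>i\<le>v. corr_coeff f p i * (f p ^ (v - i) / fact (v - i))) n"
      unfolding exp_mult_def using n f1 by (intro mult_ext_convolution) auto
    also have "\<dots> = f n"
      unfolding corr_coeff_convolution by (rule multiplicative_eq_mult_ext[OF f n, symmetric])
    finally show "f n = (\<Sum>d | d \<in> UNIV \<and> d dvd n. mult_ext (corr_coeff f) d * exp_mult f (n div d))"
      by simp
  qed
  also have "\<dots> = (\<Sum>d\<in>UNIV \<inter> {1..N}. \<Sum>m=1..N div d. mult_ext (corr_coeff f) d * exp_mult f m)"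
    by (rule sum_divisors_swap)
  finally show ?thesis by (simp add: sum_distrib_left)
qed

lemma sum_multiplicative_bound:
  fixes k A C :: real
  assumes k: "k > 0" and A: "A > 0" and C: "C \<ge> 0"
  shows "\<exists>M\<ge>0. \<forall>f. multiplicative f \<longrightarrow>
      (\<forall>n\<ge>1. norm (f n) \<le> tau k n) \<longrightarrow>
      (\<forall>n\<ge>2. norm (\<Sum>p\<in>{p. prime p} \<inter> {1..n}. f p * of_real (ln (real p)))
           \<le> C * real n / ln (real n) powr A) \<longrightarrow>
      (\<forall>N\<ge>2. norm (\<Sum>n=1..N. f n) \<le> M * real N * ln (real N) powr (k - 1 - A))"
proof -
  define b where "b = k - 1 - A"
  define B where "B = 2 powr \<bar>b\<bar>"
  define K where "K = exp (1 + 2 * k)"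
  \<comment> \<open>This constant absorbs logarithms: (1 + l)^k is at most 2^k l^b l^(A+1), and
    l^(A+1) is paid for by N^(1/16).\<close>
  define c where "c = 2 powr k * ((A + 1) / (1 / 16)) powr (A + 1)"
  obtain M1 where M1: "M1 \<ge> 0" and core: "\<And>a N.
      (\<forall>p. prime p \<longrightarrow> norm (a p) \<le> k) \<Longrightarrow>
      (\<forall>n\<ge>2. norm (\<Sum>p\<in>{p. prime p} \<inter> {1..n}. a p * of_real (ln (real p)))
           \<le> C * real n / ln (real n) powr A) \<Longrightarrow>
      N \<ge> 2 \<Longrightarrow> norm (\<Sum>m=1..N. exp_mult a m) \<le> M1 * real N * ln (real N) powr b"
    using sum_exp_mult_bound[OF assms] unfolding b_def by blast
  obtain H where H: "H \<ge> 0" and corr: "\<And>f N. f 1 = 1 \<Longrightarrow> (\<forall>n\<ge>1. norm (f n) \<le> tau k n) \<Longrightarrow>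
     (\<Sum>d=1..N. norm (mult_ext (corr_coeff f) d) * real d powr - (3 / 4)) \<le> H"
    using sum_corr_coeff_bounded[OF k] by blast
  define t where "t = (\<lambda>N. (\<Sum>n=1..N. \<bar>tau k n\<bar>) / (real N * ln (real N) powr b))"
  define M2 where "M2 = H * (M1 * B + K * c)"
  define M where "M = M2 + (\<Sum>N=2..16. t N)"
  have t0: "t N \<ge> 0" for N by (simp add: t_def sum_nonneg)
  have M2: "M2 \<ge> 0" using H M1 by (simp add: M2_def B_def K_def c_def)
  have M0: "M \<ge> 0" using M2 t0 by (simp add: M_def sum_nonneg)
  have "norm (\<Sum>n=1..N. f n) \<le> M * real N * ln (real N) powr b"
    if f: "multiplicative f" "\<forall>n\<ge>1. norm (f n) \<le> tau k n"
      and E: "\<forall>n\<ge>2. norm (\<Sum>p\<in>{p. prime p} \<inter> {1..n}. f p * of_real (ln (real p)))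
           \<le> C * real n / ln (real n) powr A"
      and N2: "N \<ge> 2" for f N
  proof (cases "N \<ge> 16")
    case False
    have "norm (\<Sum>n=1..N. f n) \<le> (\<Sum>n=1..N. \<bar>tau k n\<bar>)"
      using f(2) by (intro sum_norm_le) (auto intro: order_trans[OF _ abs_ge_self])
    also have "\<dots> = t N * (real N * ln (real N) powr b)" using N2 by (simp add: t_def)
    also have "\<dots> \<le> M * (real N * ln (real N) powr b)"
    proof (intro mult_right_mono)
      have "t N \<le> (\<Sum>N=2..16. t N)" using N2 False t0 by (intro member_le_sum) auto
      thus "t N \<le> M" using M2 by (simp add: M_def)
    qed auto
    finally show ?thesis by (simp add: mult_ac)
  next
    case True
    define l where "l = ln (real N)"
    have f1: "f 1 = 1" using f(1) by (simp add: multiplicative_def)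
    have ak: "\<forall>p. prime p \<longrightarrow> norm (f p) \<le> k"
      using f(2) tau_prime prime_ge_1_nat by metis
    have "exp 1 \<le> real N" using exp_le True by linarith
    hence l1: "l \<ge> 1" using True by (simp add: l_def ln_ge_iff)
    have X: "(1 + l) powr k \<le> c * l powr b * real N powr (1 / 16)"
    proof -
      have "(1 + l) powr k \<le> 2 powr k * l powr k" using one_plus_powr_le l1 k by simp
      also have "l powr k = l powr b * l powr (A + 1)" by (simp add: b_def powr_add[symmetric])
      also have "2 powr k * (l powr b * l powr (A + 1))
          \<le> 2 powr k * (l powr b * (((A + 1) / (1 / 16)) powr (A + 1) * real N powr (1 / 16)))"
        using A True unfolding l_def by (intro mult_left_mono ln_powr_le_powr) auto
      finally show ?thesis by (simp add: c_def mult_ac)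
    qed
    have S: "norm (\<Sum>m=1..N div d. exp_mult f m) \<le> (M1 * B + K * c) * real N * l powr b * real d powr - (3 / 4)"
      if d: "d \<in> {1..N}" for d
    proof -
      have dN: "real (N div d) \<le> real N / real d" by (rule of_nat_div_le_of_nat)
      \<comment> \<open>A factor d^(-1/4) is set aside. For d <= N^(1/4) it is bounded by 1 and the
        main estimate is applied at \<open>N div d\<close>; for larger d it cancels the N^(1/16)
        that the trivial bound costs.\<close>
      have split: "1 / real d = real d powr - (3 / 4) * real d powr - (1 / 4)"
        using d by (simp add: powr_add[symmetric] powr_minus_divide)
      show ?thesis
      proof (cases "real d \<le> real N powr (1 / 4)")
        case le: True
        have sq: "sqrt (real N) \<le> real (N div d)" using True d le by (intro sqrt_le_div) auto
        have "sqrt 16 \<le> sqrt (real N)" using True by (subst real_sqrt_le_iff) simp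
        hence "N div d \<ge> 2" using sq by simp
        hence "norm (\<Sum>m=1..N div d. exp_mult f m) \<le> M1 * real (N div d) * ln (real (N div d)) powr b"
          by (intro core ak E)
        also have "\<dots> \<le> M1 * (real N / real d) * (B * l powr b)"
          unfolding B_def l_def using sq True M1 dN
          by (intro mult_mono mult_nonneg_nonneg ln_powr_le_of_sqrt_le) (auto intro: div_le_dividend)
        also have "\<dots> = M1 * B * real N * l powr b * (1 / real d)" by simp
        also have "1 / real d \<le> real d powr - (3 / 4) * 1"
          unfolding split using d by (intro mult_left_mono) (auto simp: powr_minus_divide ge_one_powr_ge_zero)
        hence "M1 * B * real N * l powr b * (1 / real d)
            \<le> M1 * B * real N * l powr b * (real d powr - (3 / 4))"
          using M1 by (intro mult_left_mono) (auto simp: B_def)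
        also have "\<dots> \<le> (M1 * B + K * c) * real N * l powr b * real d powr - (3 / 4)"
          by (intro mult_right_mono) (auto simp: K_def c_def)
        finally show ?thesis .
      next
        case False
        have nd: "N div d \<ge> 1" using d by (simp add: Suc_le_eq div_greater_zero_iff)
        have "norm (\<Sum>m=1..N div d. exp_mult f m) \<le> K * real (N div d) * (1 + ln (real (N div d))) powr k"
          unfolding K_def using k ak nd by (intro norm_sum_exp_mult_le) auto
        also have "\<dots> \<le> K * (real N / real d) * (c * l powr b * real N powr (1 / 16))"
        proof (intro mult_mono mult_nonneg_nonneg)
          have "ln (real (N div d)) \<le> l"
            unfolding l_def using nd True by (subst ln_le_cancel_iff) auto
          hence "(1 + ln (real (N div d))) powr k \<le> (1 + l) powr k"
            using k nd by (intro powr_mono2) auto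
          thus "(1 + ln (real (N div d))) powr k \<le> c * l powr b * real N powr (1 / 16)"
            using X by linarith
        qed (use dN in \<open>auto simp: K_def\<close>)
        also have "\<dots> = K * c * real N * l powr b * (real N powr (1 / 16) * (1 / real d))" by simp
        also have "real N powr (1 / 16) * (1 / real d) \<le> 1 * real d powr - (3 / 4)"
        proof -
          have "real N powr (1 / 16) = (real N powr (1 / 4)) powr (1 / 4)" by (simp add: powr_powr)
          also have "\<dots> \<le> real d powr (1 / 4)" using False by (intro powr_mono2) auto
          finally have "real N powr (1 / 16) * real d powr - (1 / 4) \<le> real d powr (1 / 4) * real d powr - (1 / 4)"
            by (intro mult_right_mono) auto
          also have "\<dots> = 1" using d by (simp add: powr_add[symmetric])
          finally have "(real N powr (1 / 16) * real d powr - (1 / 4)) * real d powr - (3 / 4) \<le> 1 * real d powr - (3 / 4)"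
            by (intro mult_right_mono) auto
          thus ?thesis unfolding split by (simp add: mult_ac)
        qed
        hence "K * c * real N * l powr b * (real N powr (1 / 16) * (1 / real d))
            \<le> K * c * real N * l powr b * (1 * real d powr - (3 / 4))"
          by (intro mult_left_mono) (auto simp: K_def c_def)
        also have "\<dots> \<le> (M1 * B + K * c) * real N * l powr b * real d powr - (3 / 4)"
          unfolding mult_1 using M1 by (intro mult_right_mono) (auto simp: B_def)
        finally show ?thesis .
      qed
    qed
    have "norm (\<Sum>n=1..N. f n)
        \<le> (\<Sum>d=1..N. (M1 * B + K * c) * real N * l powr b * (norm (mult_ext (corr_coeff f) d) * real d powr - (3 / 4)))"
      unfolding sum_multiplicative_eq[OF f(1)]
    proof (intro sum_norm_le)
      fix d assume "d \<in> {1..N}"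
      from mult_left_mono[OF S[OF this], of "norm (mult_ext (corr_coeff f) d)"]
      show "norm (mult_ext (corr_coeff f) d * (\<Sum>m=1..N div d. exp_mult f m))
          \<le> (M1 * B + K * c) * real N * l powr b * (norm (mult_ext (corr_coeff f) d) * real d powr - (3 / 4))"
        by (simp add: norm_mult mult_ac)
    qed
    also have "\<dots> = (M1 * B + K * c) * real N * l powr b *
        (\<Sum>d=1..N. norm (mult_ext (corr_coeff f) d) * real d powr - (3 / 4))"
      by (simp add: sum_distrib_left)
    also have "\<dots> \<le> (M1 * B + K * c) * real N * l powr b * H"
      using corr[OF f1 f(2)] M1 by (intro mult_left_mono) (auto simp: B_def K_def c_def)
    also have "\<dots> = M2 * (real N * l powr b)" by (simp add: M2_def mult_ac)
    also have "\<dots> \<le> M * (real N * l powr b)"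
      using t0 by (intro mult_right_mono) (auto simp: M_def sum_nonneg)
    finally show ?thesis by (simp add: l_def mult_ac)
  qed
  thus ?thesis unfolding b_def[symmetric] using M0 by blast
qed

section \<open>From integers to real arguments\<close>

theorem theorem4p1:
  fixes k A C :: real
  assumes "k > 0" and "A > 0"
  shows "\<exists>M::real. \<forall>f::nat \<Rightarrow> complex.
           multiplicative f \<longrightarrow>
           (\<forall>n\<ge>1. norm (f n) \<le> tau k n) \<longrightarrow>
           (\<forall>x::real. x \<ge> 2 \<longrightarrow>
              norm (\<Sum>p | prime p \<and> real p \<le> x. f p * of_real (ln (real p)))
                \<le> C * x / (ln x) powr A) \<longrightarrow>
           (\<forall>x::real. x \<ge> 2 \<longrightarrow>
              norm (\<Sum>n\<in>{1..nat \<lfloor>x\<rfloor>}. f n) \<le> M * x * (ln x) powr (k - 1 - A))"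
proof -
  define b where "b = k - 1 - A"
  \<comment> \<open>\<open>C\<close> may be negative, while the integer version takes a nonnegative
    constant; hence \<open>max C 0\<close>.\<close>
  obtain M where M: "M \<ge> 0" and bound: "\<And>f N. multiplicative f \<Longrightarrow>
      (\<forall>n\<ge>1. norm (f n) \<le> tau k n) \<Longrightarrow>
      (\<forall>n\<ge>2. norm (\<Sum>p\<in>{p. prime p} \<inter> {1..n}. f p * of_real (ln (real p)))
           \<le> max C 0 * real n / ln (real n) powr A) \<Longrightarrow>
      N \<ge> 2 \<Longrightarrow> norm (\<Sum>n=1..N. f n) \<le> M * real N * ln (real N) powr b"
    using sum_multiplicative_bound[OF assms, of "max C 0"] unfolding b_def by auto
  have "norm (\<Sum>n\<in>{1..nat \<lfloor>x\<rfloor>}. f n) \<le> M * 2 powr \<bar>b\<bar> * x * ln x powr b"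
    if f: "multiplicative f" "\<forall>n\<ge>1. norm (f n) \<le> tau k n"
      and E: "\<forall>x::real. x \<ge> 2 \<longrightarrow>
              norm (\<Sum>p | prime p \<and> real p \<le> x. f p * of_real (ln (real p)))
                \<le> C * x / (ln x) powr A"
      and x: "x \<ge> 2" for f and x :: real
  proof -
    have "norm (\<Sum>p\<in>{p. prime p} \<inter> {1..n}. f p * of_real (ln (real p)))
           \<le> max C 0 * real n / ln (real n) powr A" if n: "n \<ge> 2" for n :: nat
    proof -
      have eq: "{p. prime p} \<inter> {1..n} = {p. prime p \<and> real p \<le> real n}"
        by (auto simp: prime_ge_Suc_0_nat)
      have "norm (\<Sum>p\<in>{p. prime p} \<inter> {1..n}. f p * of_real (ln (real p))) \<le> C * real n / ln (real n) powr A"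
        unfolding eq using n by (intro E[rule_format]) simp
      also have "\<dots> \<le> max C 0 * real n / ln (real n) powr A"
        by (intro divide_right_mono mult_right_mono) auto
      finally show ?thesis .
    qed
    moreover have "nat \<lfloor>x\<rfloor> \<ge> 2" using x by (simp add: le_nat_iff le_floor_iff)
    ultimately have "norm (\<Sum>n\<in>{1..nat \<lfloor>x\<rfloor>}. f n)
        \<le> M * real (nat \<lfloor>x\<rfloor>) * ln (real (nat \<lfloor>x\<rfloor>)) powr b"
      using f by (intro bound) auto
    \<comment> \<open>The floor of x lies between sqrt x and x, so the change of logarithm costs
      \<open>2 powr \<bar>b\<bar>\<close> whatever the sign of b.\<close>
    also have "\<dots> \<le> M * x * (2 powr \<bar>b\<bar> * ln x powr b)"
      using x M sqrt_le_floor[OF x]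
      by (intro mult_mono ln_powr_le_of_sqrt_le mult_nonneg_nonneg of_nat_floor) auto
    finally show ?thesis by (simp add: mult_ac)
  qed
  thus ?thesis unfolding b_def[symmetric] by (intro exI[of _ "M * 2 powr \<bar>b\<bar>"]) blast
qed

end
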